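(* Let $\sigma$ be a finite or countable signature, $\psi$ a strictly limited complexity measure over $\sigma$ for which $K_\psi$ is a total recursive function, $C$ a nonempty class of structures of $\sigma$, and $H$ a nonempty subset of $H(\sigma)$. If the problem of solvability for the quadruple $(\mathrm{Probl}(\sigma),\mathrm{Tree}(\sigma),H,C)$ is decidable, then the problem of optimization for the triple $(\psi,H,C)$ is decidable.
   Context: Notation: $\omega=\{0,1,2,\dots\}$, $E_2=\{0,1\}$, variables $X=\{x_i:i\in\omega\}$, $X_n=\{x_0,\dots,x_{n-1}\}$; $\alpha^1=\alpha$, $\alpha^0=\neg\alpha$. The signature $\sigma$ (predicate and function symbols with arities, containing predicate symbols) is written $\{q_0,\dots,q_m\}$ or $\{q_0,q_1,\dots\}$; $\sigma^*$ is the set of finite words over $\sigma$ including the empty word $\lambda$. A complexity measure is $\psi:\sigma^*\to\omega$; it is strictly limited if computable and $\psi(\alpha_1\alpha_2\alpha_3)>\psi(\alpha_1\alpha_3)$ whenever $\alpha_2\ne\lambda$. For $i\in\omega$, $\omega_\psi(i)=\{q_j\in\sigma:\psi(q_j)=i\}$; $K_\psi$ is the partial function $\omega\to\omega$ with $K_\psi(i)=|\omega_\psi(i)|$ if this set is finite and undefined otherwise. A function expression is $x_j\Leftarrow f(x_{l_1},\dots,x_{l_m})$ ($f$ an $m$-ary function symbol); an (equality-free) predicate expression is $r(x_{l_1},\dots,x_{l_k})$ ($r$ a $k$-ary predicate symbol). For $n\ge1$ and a sequence $\beta=\beta_1,\dots,\beta_m$ define term sequences $M_i=(t_{i0},t_{i1},\dots)$: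 $M_1=(x_0,\dots,x_{n-1},x_{n-1},\dots)$; $M_{i+1}=M_i$ if $\beta_i$ is a predicate expression; if $\beta_i$ is $x_j\Leftarrow f(x_{l_1},\dots,x_{l_m})$, $M_{i+1}$ is $M_i$ with $t_{ij}$ replaced by $f(t_{il_1},\dots,t_{il_m})$. For predicate $\beta_i=r(x_{l_1},\dots,x_{l_k})$, $\kappa(n,\beta,\beta_i)=r(t_{il_1},\dots,t_{il_k})$. $\mathrm{word}(\beta)=q_{i_1}\cdots q_{i_m}$ where $q_{i_j}$ is the symbol in $\beta_j$. $\mathrm{Tree}(\sigma)$: schemes $S=(n,G)$, $n\ge1$, $G$ a finite rooted directed tree with function nodes (function expression, one outgoing edge), predicate nodes (equality-free predicate expression, two outgoing edges labeled $0,1$), terminal nodes (labeled by numbers in $\omega$). For a complete path $\tau=w_1,d_1,\dots,w_m,d_m,w_{m+1}$ with expressions $\beta_\tau=\beta_1,\dots,\beta_m$, $F(\tau)$ is the set of $\kappa(n,\beta_\tau,\beta_i)^c$ for predicate nodes $w_i$, $c$ the label of $d_i$ (a tautology if none), $t_\tau$ the terminal label. For a structure $U$ with universe $A$, $\varphi_{(S,U)}(\bar a)=t_\tau$ for the unique complete path $\tau$ with all of $F(\tau)$ true in $U$ on $\bar a\in A^n$. $\psi(S)=\max_\tau\psi(\mathrm{word}(\beta_\tau))$ over complete paths. $\mathrm{Probl}(\sigma)$: schemes $s=(n,\nu,\beta_1,\dots,\beta_m)$, $n,m\ge1$, equality-free expressions with exactly $k\ge1$ predicate expressions $\beta_{i_1},\dots,\beta_{i_k}$,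 $\nu:E_2^k\to\omega$; with $\alpha_j=\kappa(n,\beta,\beta_{i_j})$, $\varphi_{(s,U)}(\bar a)=\nu(\alpha_1(\bar a),\dots,\alpha_k(\bar a))$. $S=(n_1,G)$ solves $s=(n_2,\dots)$ relative to class $C$ if $n_1=n_2$ and either $C=\emptyset$ or $\varphi_{(S,U)}=\varphi_{(s,U)}$ for all $U\in C$. $H(\sigma)$: equality-free sentences of $\sigma$; $C(\alpha)=\{U\in C:U\models\alpha\}$. Problem of solvability for $(\mathrm{Probl}(\sigma),\mathrm{Tree}(\sigma),H,C)$: given $\alpha\in H$, $s\in\mathrm{Probl}(\sigma)$, $S\in\mathrm{Tree}(\sigma)$, decide whether $S$ solves $s$ relative to $C(\alpha)$. Problem of optimization for $(\psi,H,C)$: given $\alpha\in H$ and $s\in\mathrm{Probl}(\sigma)$, find $S\in\mathrm{Tree}(\sigma)$ that solves $s$ relative to $C(\alpha)$ and has minimum $\psi(S)$ among such schemes. A problem is decidable if an algorithm solves it.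
   Formalization: For an infinite signature it is also assumed that the kind and arity of q_j are computable from j (without this the claim fails); structures in C have universes inside one arbitrary set, to which any class reduces by Löwenheim–Skolem. *)

theory Defs
  imports Main "HOL-Library.Nat_Bijection" "HOL-Library.Extended_Nat"
begin

section \<open>Partial recursive functions\<close>

text \<open>Unary presentation: several arguments are passed through the Cantor pairing
  \<^const>\<open>prod_encode\<close>; \<^const>\<open>None\<close> means divergence.\<close>

definition pair_fn :: "(nat \<Rightarrow> nat option) \<Rightarrow> (nat \<Rightarrow> nat option) \<Rightarrow> nat \<Rightarrow> nat option" where
  "pair_fn f g x = Option.bind (f x) (\<lambda>a. Option.bind (g x) (\<lambda>b. Some (prod_encode (a, b))))"

text \<open>On the argument \<open>(a, m)\<close>: \<open>h(a, 0) = f(a)\<close> and \<open>h(a, k + 1) = g(a, (k, h(a, k)))\<close>.\<close>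
definition prim_rec :: "(nat \<Rightarrow> nat option) \<Rightarrow> (nat \<Rightarrow> nat option) \<Rightarrow> nat \<Rightarrow> nat option" where
  "prim_rec f g x = (case prod_decode x of (a, m) \<Rightarrow>
     rec_nat (f a) (\<lambda>k r. Option.bind r (\<lambda>y. g (prod_encode (a, prod_encode (k, y))))) m)"

definition minimize :: "(nat \<Rightarrow> nat option) \<Rightarrow> nat \<Rightarrow> nat option" where
  "minimize f a =
     (if \<exists>m. f (prod_encode (a, m)) = Some 0 \<and> (\<forall>k<m. f (prod_encode (a, k)) \<noteq> None)
      then Some (LEAST m. f (prod_encode (a, m)) = Some 0) else None)"

inductive partrec :: "(nat \<Rightarrow> nat option) \<Rightarrow> bool" where
  zero: "partrec (\<lambda>_. Some 0)"
| succ: "partrec (\<lambda>x. Some (Suc x))"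
| left: "partrec (\<lambda>x. Some (fst (prod_decode x)))"
| right: "partrec (\<lambda>x. Some (snd (prod_decode x)))"
| pair: "partrec f \<Longrightarrow> partrec g \<Longrightarrow> partrec (pair_fn f g)"
| comp: "partrec f \<Longrightarrow> partrec g \<Longrightarrow> partrec (f \<circ>\<^sub>m g)"
| prec: "partrec f \<Longrightarrow> partrec g \<Longrightarrow> partrec (prim_rec f g)"
| mu: "partrec f \<Longrightarrow> partrec (minimize f)"

definition total_recursive :: "(nat \<Rightarrow> nat option) \<Rightarrow> bool" where
  "total_recursive f \<longleftrightarrow> partrec f \<and> (\<forall>x. f x \<noteq> None)"


section \<open>Signatures, structures, equality-free formulas\<close>

datatype sym_kind = Predicate | Function

text \<open>The symbol \<open>q\<^sub>j\<close> is represented by its index \<open>j\<close>; \<open>sig_size\<close> is the number of symbols,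
  \<open>\<infinity>\<close> for a countably infinite signature. The values of \<open>kind\<close> and \<open>arity\<close> at
  other indices are irrelevant.\<close>
record signature =
  sig_size :: enat
  kind :: "nat \<Rightarrow> sym_kind"
  arity :: "nat \<Rightarrow> nat"

definition symbols :: "signature \<Rightarrow> nat set" where
  "symbols \<sigma> = {j. enat j < sig_size \<sigma>}"

definition pred_symbol :: "signature \<Rightarrow> nat \<Rightarrow> bool" where
  "pred_symbol \<sigma> r \<longleftrightarrow> r \<in> symbols \<sigma> \<and> kind \<sigma> r = Predicate"

definition fun_symbol :: "signature \<Rightarrow> nat \<Rightarrow> bool" where
  "fun_symbol \<sigma> f \<longleftrightarrow> f \<in> symbols \<sigma> \<and> kind \<sigma> f = Function"

text \<open>The enumeration \<open>q\<^sub>0, q\<^sub>1, \<dots>\<close> presents the signature effectively: the kind and the arity of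
  \<open>q\<^sub>j\<close> can be computed from \<open>j\<close>. This holds automatically for every finite signature.\<close>
definition effectively_enumerated :: "signature \<Rightarrow> bool" where
  "effectively_enumerated \<sigma> \<longleftrightarrow>
     (\<exists>f. partrec f \<and> (\<forall>j\<in>symbols \<sigma>.
        f j = Some (prod_encode (if kind \<sigma> j = Predicate then 1 else 0, arity \<sigma> j))))"

record 'a struct =
  univ :: "'a set"
  fun_interp :: "nat \<Rightarrow> 'a list \<Rightarrow> 'a"
  pred_interp :: "nat \<Rightarrow> 'a list \<Rightarrow> bool"

definition is_struct :: "signature \<Rightarrow> 'a struct \<Rightarrow> bool" where
  "is_struct \<sigma> U \<longleftrightarrow> univ U \<noteq> {} \<and>
     (\<forall>f as. fun_symbol \<sigma> f \<and> length as = arity \<sigma> f \<and> set as \<subseteq> univ U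
        \<longrightarrow> fun_interp U f as \<in> univ U)"

datatype tm = Var nat | App nat "tm list"

datatype fm = Atom nat "tm list" | Neg fm | And fm fm | Or fm fm | Imp fm fm
  | All nat fm | Ex nat fm

fun wf_tm :: "signature \<Rightarrow> tm \<Rightarrow> bool" where
  "wf_tm \<sigma> (Var i) \<longleftrightarrow> True"
| "wf_tm \<sigma> (App f ts) \<longleftrightarrow> fun_symbol \<sigma> f \<and> length ts = arity \<sigma> f \<and> (\<forall>t\<in>set ts. wf_tm \<sigma> t)"

fun wf_fm :: "signature \<Rightarrow> fm \<Rightarrow> bool" where
  "wf_fm \<sigma> (Atom r ts) \<longleftrightarrow> pred_symbol \<sigma> r \<and> length ts = arity \<sigma> r \<and> (\<forall>t\<in>set ts. wf_tm \<sigma> t)"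
| "wf_fm \<sigma> (Neg p) \<longleftrightarrow> wf_fm \<sigma> p"
| "wf_fm \<sigma> (And p q) \<longleftrightarrow> wf_fm \<sigma> p \<and> wf_fm \<sigma> q"
| "wf_fm \<sigma> (Or p q) \<longleftrightarrow> wf_fm \<sigma> p \<and> wf_fm \<sigma> q"
| "wf_fm \<sigma> (Imp p q) \<longleftrightarrow> wf_fm \<sigma> p \<and> wf_fm \<sigma> q"
| "wf_fm \<sigma> (All x p) \<longleftrightarrow> wf_fm \<sigma> p"
| "wf_fm \<sigma> (Ex x p) \<longleftrightarrow> wf_fm \<sigma> p"

fun vars_tm :: "tm \<Rightarrow> nat set" where
  "vars_tm (Var i) = {i}"
| "vars_tm (App f ts) = (\<Union>t\<in>set ts. vars_tm t)"

fun free_vars :: "fm \<Rightarrow> nat set" where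
  "free_vars (Atom r ts) = (\<Union>t\<in>set ts. vars_tm t)"
| "free_vars (Neg p) = free_vars p"
| "free_vars (And p q) = free_vars p \<union> free_vars q"
| "free_vars (Or p q) = free_vars p \<union> free_vars q"
| "free_vars (Imp p q) = free_vars p \<union> free_vars q"
| "free_vars (All x p) = free_vars p - {x}"
| "free_vars (Ex x p) = free_vars p - {x}"

definition sentences :: "signature \<Rightarrow> fm set" where
  "sentences \<sigma> = {p. wf_fm \<sigma> p \<and> free_vars p = {}}"

fun eval_tm :: "'a struct \<Rightarrow> (nat \<Rightarrow> 'a) \<Rightarrow> tm \<Rightarrow> 'a" where
  "eval_tm U e (Var i) = e i"
| "eval_tm U e (App f ts) = fun_interp U f (map (eval_tm U e) ts)"

fun sat :: "'a struct \<Rightarrow> (nat \<Rightarrow> 'a) \<Rightarrow> fm \<Rightarrow> bool" where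
  "sat U e (Atom r ts) \<longleftrightarrow> pred_interp U r (map (eval_tm U e) ts)"
| "sat U e (Neg p) \<longleftrightarrow> \<not> sat U e p"
| "sat U e (And p q) \<longleftrightarrow> sat U e p \<and> sat U e q"
| "sat U e (Or p q) \<longleftrightarrow> sat U e p \<or> sat U e q"
| "sat U e (Imp p q) \<longleftrightarrow> (sat U e p \<longrightarrow> sat U e q)"
| "sat U e (All x p) \<longleftrightarrow> (\<forall>a\<in>univ U. sat U (e(x := a)) p)"
| "sat U e (Ex x p) \<longleftrightarrow> (\<exists>a\<in>univ U. sat U (e(x := a)) p)"

definition models :: "'a struct \<Rightarrow> fm \<Rightarrow> bool" where
  "models U p \<longleftrightarrow> (\<forall>e. range e \<subseteq> univ U \<longrightarrow> sat U e p)"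

definition models_class :: "'a struct set \<Rightarrow> fm \<Rightarrow> 'a struct set" where
  "models_class C p = {U \<in> C. models U p}"


section \<open>Expressions\<close>

text \<open>\<open>FunE j f ls\<close> is \<open>x\<^sub>j \<Leftarrow> f(x\<^sub>l : l \<in> ls)\<close> and \<open>PredE r ls\<close> is \<open>r(x\<^sub>l : l \<in> ls)\<close>.\<close>
datatype expr = FunE nat nat "nat list" | PredE nat "nat list"

fun wf_expr :: "signature \<Rightarrow> expr \<Rightarrow> bool" where
  "wf_expr \<sigma> (FunE j f ls) \<longleftrightarrow> fun_symbol \<sigma> f \<and> length ls = arity \<sigma> f"
| "wf_expr \<sigma> (PredE r ls) \<longleftrightarrow> pred_symbol \<sigma> r \<and> length ls = arity \<sigma> r"

fun is_pred :: "expr \<Rightarrow> bool" where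
  "is_pred (FunE j f ls) = False"
| "is_pred (PredE r ls) = True"

fun symbol :: "expr \<Rightarrow> nat" where
  "symbol (FunE j f ls) = f"
| "symbol (PredE r ls) = r"

definition word :: "expr list \<Rightarrow> nat list" where
  "word \<beta> = map symbol \<beta>"

fun step :: "expr \<Rightarrow> (nat \<Rightarrow> tm) \<Rightarrow> nat \<Rightarrow> tm" where
  "step (FunE j f ls) M = M(j := App f (map M ls))"
| "step (PredE r ls) M = M"

text \<open>Sequences of expressions are indexed from 0, so \<open>term_seq n \<beta> i\<close> is \<open>M\<^sub>i\<^sub>+\<^sub>1\<close>, the contents
  of the variables just before \<open>\<beta> ! i\<close> is executed.\<close>
fun term_seq :: "nat \<Rightarrow> expr list \<Rightarrow> nat \<Rightarrow> nat \<Rightarrow> tm" where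
  "term_seq n \<beta> 0 = (\<lambda>j. Var (min j (n - 1)))"
| "term_seq n \<beta> (Suc i) = step (\<beta> ! i) (term_seq n \<beta> i)"

text \<open>Used only at positions \<open>i\<close> holding a predicate expression.\<close>
definition kappa :: "nat \<Rightarrow> expr list \<Rightarrow> nat \<Rightarrow> fm" where
  "kappa n \<beta> i = (case \<beta> ! i of PredE r ls \<Rightarrow> Atom r (map (term_seq n \<beta> i) ls) | _ \<Rightarrow> undefined)"

definition literal :: "fm \<Rightarrow> bool \<Rightarrow> fm" where
  "literal p c = (if c then p else Neg p)"

definition tuples :: "'a struct \<Rightarrow> nat \<Rightarrow> 'a list set" where
  "tuples U n = {a. length a = n \<and> set a \<subseteq> univ U}"


section \<open>Tree schemes\<close>

text \<open>In \<open>PredNode r ls G0 G1\<close> the edge to \<open>G0\<close> is labeled 0 and the edge to \<open>G1\<close> is labeled 1.\<close>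
datatype tree =
    Terminal nat
  | FunNode nat nat "nat list" tree
  | PredNode nat "nat list" tree tree

fun wf_tree :: "signature \<Rightarrow> tree \<Rightarrow> bool" where
  "wf_tree \<sigma> (Terminal t) \<longleftrightarrow> True"
| "wf_tree \<sigma> (FunNode j f ls G) \<longleftrightarrow> wf_expr \<sigma> (FunE j f ls) \<and> wf_tree \<sigma> G"
| "wf_tree \<sigma> (PredNode r ls G0 G1) \<longleftrightarrow> wf_expr \<sigma> (PredE r ls) \<and> wf_tree \<sigma> G0 \<and> wf_tree \<sigma> G1"

type_synonym tree_scheme = "nat \<times> tree"

definition Tree :: "signature \<Rightarrow> tree_scheme set" where
  "Tree \<sigma> = {(n, G). n \<ge> 1 \<and> wf_tree \<sigma> G}"

text \<open>A complete path is given by the expressions of its nonterminal nodes, each with the label of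
  the edge leaving it (\<^const>\<open>None\<close> for the unlabeled edge leaving a function node), and the
  label of its terminal node.\<close>
type_synonym path = "(expr \<times> bool option) list \<times> nat"

fun complete_paths :: "tree \<Rightarrow> path set" where
  "complete_paths (Terminal t) = {([], t)}"
| "complete_paths (FunNode j f ls G) =
     (\<lambda>(p, t). ((FunE j f ls, None) # p, t)) ` complete_paths G"
| "complete_paths (PredNode r ls G0 G1) =
     (\<lambda>(p, t). ((PredE r ls, Some False) # p, t)) ` complete_paths G0 \<union>
     (\<lambda>(p, t). ((PredE r ls, Some True) # p, t)) ` complete_paths G1"

definition path_exprs :: "path \<Rightarrow> expr list" where
  "path_exprs \<tau> = map fst (fst \<tau>)"

definition path_formulas :: "nat \<Rightarrow> path \<Rightarrow> fm set" where
  "path_formulas n \<tau> = {literal (kappa n (path_exprs \<tau>) i) c | i c.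
     i < length (fst \<tau>) \<and> snd (fst \<tau> ! i) = Some c}"

definition tree_fun :: "tree_scheme \<Rightarrow> 'a struct \<Rightarrow> 'a list \<Rightarrow> nat" where
  "tree_fun S U a = (case S of (n, G) \<Rightarrow>
     snd (THE \<tau>. \<tau> \<in> complete_paths G \<and> (\<forall>p\<in>path_formulas n \<tau>. sat U (\<lambda>i. a ! i) p)))"

definition tree_complexity :: "(nat list \<Rightarrow> nat) \<Rightarrow> tree_scheme \<Rightarrow> nat" where
  "tree_complexity \<psi> S = Max ((\<lambda>\<tau>. \<psi> (word (path_exprs \<tau>))) ` complete_paths (snd S))"


section \<open>Problem schemes\<close>

text \<open>In \<open>(n, \<nu>, \<beta>)\<close> only the values of \<open>\<nu>\<close> on lists of length \<open>k\<close> matter, where \<open>k\<close> is the number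
  of predicate expressions in \<open>\<beta>\<close>.\<close>
type_synonym probl_scheme = "nat \<times> (bool list \<Rightarrow> nat) \<times> expr list"

definition pred_positions :: "expr list \<Rightarrow> nat list" where
  "pred_positions \<beta> = filter (\<lambda>i. is_pred (\<beta> ! i)) [0..<length \<beta>]"

definition Probl :: "signature \<Rightarrow> probl_scheme set" where
  "Probl \<sigma> = {(n, \<nu>, \<beta>). n \<ge> 1 \<and> length \<beta> \<ge> 1 \<and> (\<forall>b\<in>set \<beta>. wf_expr \<sigma> b) \<and>
     length (pred_positions \<beta>) \<ge> 1}"

definition probl_fun :: "probl_scheme \<Rightarrow> 'a struct \<Rightarrow> 'a list \<Rightarrow> nat" where
  "probl_fun s U a = (case s of (n, \<nu>, \<beta>) \<Rightarrow>
     \<nu> (map (\<lambda>i. sat U (\<lambda>j. a ! j) (kappa n \<beta> i)) (pred_positions \<beta>)))"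

definition solves :: "tree_scheme \<Rightarrow> probl_scheme \<Rightarrow> 'a struct set \<Rightarrow> bool" where
  "solves S s C \<longleftrightarrow> fst S = fst s \<and>
     (C = {} \<or> (\<forall>U\<in>C. \<forall>a\<in>tuples U (fst s). tree_fun S U a = probl_fun s U a))"


section \<open>Complexity measures\<close>

definition computable_measure :: "signature \<Rightarrow> (nat list \<Rightarrow> nat) \<Rightarrow> bool" where
  "computable_measure \<sigma> \<psi> \<longleftrightarrow>
     (\<exists>f. partrec f \<and> (\<forall>w\<in>lists (symbols \<sigma>). f (list_encode w) = Some (\<psi> w)))"

definition strictly_limited :: "signature \<Rightarrow> (nat list \<Rightarrow> nat) \<Rightarrow> bool" where
  "strictly_limited \<sigma> \<psi> \<longleftrightarrow> computable_measure \<sigma> \<psi> \<and>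
     (\<forall>u\<in>lists (symbols \<sigma>). \<forall>v\<in>lists (symbols \<sigma>). \<forall>w\<in>lists (symbols \<sigma>).
        v \<noteq> [] \<longrightarrow> \<psi> (u @ v @ w) > \<psi> (u @ w))"

definition omega_psi :: "signature \<Rightarrow> (nat list \<Rightarrow> nat) \<Rightarrow> nat \<Rightarrow> nat set" where
  "omega_psi \<sigma> \<psi> i = {j \<in> symbols \<sigma>. \<psi> [j] = i}"

definition K_psi :: "signature \<Rightarrow> (nat list \<Rightarrow> nat) \<Rightarrow> nat \<Rightarrow> nat option" where
  "K_psi \<sigma> \<psi> i = (if finite (omega_psi \<sigma> \<psi> i) then Some (card (omega_psi \<sigma> \<psi> i)) else None)"


section \<open>Encoding of finite objects and decidability of problems\<close>

fun enc_tm :: "tm \<Rightarrow> nat" where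
  "enc_tm (Var i) = prod_encode (0, i)"
| "enc_tm (App f ts) = prod_encode (1, prod_encode (f, list_encode (map enc_tm ts)))"

fun enc_fm :: "fm \<Rightarrow> nat" where
  "enc_fm (Atom r ts) = prod_encode (0, prod_encode (r, list_encode (map enc_tm ts)))"
| "enc_fm (Neg p) = prod_encode (1, enc_fm p)"
| "enc_fm (And p q) = prod_encode (2, prod_encode (enc_fm p, enc_fm q))"
| "enc_fm (Or p q) = prod_encode (3, prod_encode (enc_fm p, enc_fm q))"
| "enc_fm (Imp p q) = prod_encode (4, prod_encode (enc_fm p, enc_fm q))"
| "enc_fm (All x p) = prod_encode (5, prod_encode (x, enc_fm p))"
| "enc_fm (Ex x p) = prod_encode (6, prod_encode (x, enc_fm p))"

fun enc_expr :: "expr \<Rightarrow> nat" where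
  "enc_expr (FunE j f ls) = prod_encode (0, prod_encode (j, prod_encode (f, list_encode ls)))"
| "enc_expr (PredE r ls) = prod_encode (1, prod_encode (r, list_encode ls))"

fun enc_tree :: "tree \<Rightarrow> nat" where
  "enc_tree (Terminal t) = prod_encode (0, t)"
| "enc_tree (FunNode j f ls G) = prod_encode (1, prod_encode (enc_expr (FunE j f ls), enc_tree G))"
| "enc_tree (PredNode r ls G0 G1) =
     prod_encode (2, prod_encode (enc_expr (PredE r ls), prod_encode (enc_tree G0, enc_tree G1)))"

definition enc_tree_scheme :: "tree_scheme \<Rightarrow> nat" where
  "enc_tree_scheme S = prod_encode (fst S, enc_tree (snd S))"

text \<open>The map \<open>\<nu> : E\<^sub>2\<^sup>k \<rightarrow> \<omega>\<close> is encoded by its table of \<open>2\<^sup>k\<close> values.\<close>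
definition enc_probl_scheme :: "probl_scheme \<Rightarrow> nat" where
  "enc_probl_scheme s = (case s of (n, \<nu>, \<beta>) \<Rightarrow>
     prod_encode (n, prod_encode
       (list_encode (map \<nu> (List.n_lists (length (pred_positions \<beta>)) [False, True])),
        list_encode (map enc_expr \<beta>))))"

text \<open>As usual for problems with a prescribed set of inputs, the behaviour of an algorithm on
  numbers that do not encode admissible inputs is unconstrained.\<close>

definition solvability_decidable ::
  "probl_scheme set \<Rightarrow> tree_scheme set \<Rightarrow> fm set \<Rightarrow> 'a struct set \<Rightarrow> bool" where
  "solvability_decidable P T H C \<longleftrightarrow>
     (\<exists>f. partrec f \<and> (\<forall>\<alpha>\<in>H. \<forall>s\<in>P. \<forall>S\<in>T.
        f (prod_encode (enc_fm \<alpha>, prod_encode (enc_probl_scheme s, enc_tree_scheme S)))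
          = Some (if solves S s (models_class C \<alpha>) then 1 else 0)))"

definition optimal_solution ::
  "signature \<Rightarrow> (nat list \<Rightarrow> nat) \<Rightarrow> tree_scheme \<Rightarrow> probl_scheme \<Rightarrow> 'a struct set \<Rightarrow> bool" where
  "optimal_solution \<sigma> \<psi> S s C \<longleftrightarrow> S \<in> Tree \<sigma> \<and> solves S s C \<and>
     (\<forall>S'\<in>Tree \<sigma>. solves S' s C \<longrightarrow> tree_complexity \<psi> S \<le> tree_complexity \<psi> S')"

definition optimization_decidable ::
  "signature \<Rightarrow> (nat list \<Rightarrow> nat) \<Rightarrow> fm set \<Rightarrow> 'a struct set \<Rightarrow> bool" where
  "optimization_decidable \<sigma> \<psi> H C \<longleftrightarrow>
     (\<exists>f. partrec f \<and> (\<forall>\<alpha>\<in>H. \<forall>s\<in>Probl \<sigma>. \<exists>S.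
        f (prod_encode (enc_fm \<alpha>, enc_probl_scheme s)) = Some (enc_tree_scheme S) \<and>
        optimal_solution \<sigma> \<psi> S s (models_class C \<alpha>)))"

end

theory Submission
  imports Defs
begin

text \<open>Executing the expressions of a problem \<open>s = (n, \<nu>, \<beta>)\<close> one after the other gives a tree that
  solves \<open>s\<close> and has complexity \<open>N = \<psi>(word \<beta>)\<close>, so only trees of complexity at most \<open>N\<close> matter. As
  \<open>\<psi>\<close> is strictly limited, such a tree has depth at most \<open>N\<close> and uses only symbols \<open>q\<close> with
  \<open>\<psi>(q) \<le> N\<close>; there are finitely many of these, and they can be listed because \<open>K\<^sub>\<psi>\<close> is computable.
  Renaming the variables \<open>x\<^sub>i\<close> with \<open>i \<ge> n\<close> and replacing terminal labels that are not values of \<open>\<nu>\<close>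
  changes neither solvability nor complexity, which leaves a finite computable list of trees.
  Solvability is decided for each of them and the cheapest solution is selected.\<close>

section \<open>Computable functions between encoded types\<close>

text \<open>No injectivity is required: a function that does not respect codes is simply not computable.\<close>
class encodable =
  fixes encode :: "'a \<Rightarrow> nat"

instantiation nat :: encodable
begin
definition encode_nat :: "nat \<Rightarrow> nat" where [simp]: "encode_nat n = n"
instance ..
end

instantiation bool :: encodable
begin
definition encode_bool :: "bool \<Rightarrow> nat" where "encode_bool b = (if b then 1 else 0)"
instance ..
end

instantiation prod :: (encodable, encodable) encodable
begin
definition encode_prod :: "'a \<times> 'b \<Rightarrow> nat" where
  "encode_prod p = prod_encode (encode (fst p), encode (snd p))"
instance ..
end

instantiation list :: (encodable) encodable
begin
definition encode_list :: "'a list \<Rightarrow> nat" where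
  "encode_list l = list_encode (map encode l)"
instance ..
end

instantiation expr :: encodable
begin
definition encode_expr :: "expr \<Rightarrow> nat" where "encode_expr = enc_expr"
instance ..
end

instantiation tree :: encodable
begin
definition encode_tree :: "tree \<Rightarrow> nat" where "encode_tree = enc_tree"
instance ..
end

lemma encode_Pair [simp]: "encode (a, b) = prod_encode (encode a, encode b)"
  by (simp add: encode_prod_def)

lemma encode_Nil [simp]: "encode [] = 0"
  by (simp add: encode_list_def)

lemma encode_Cons [simp]: "encode (a # l) = Suc (prod_encode (encode a, encode l))"
  by (simp add: encode_list_def)

lemma encode_nat_list: "encode (w :: nat list) = list_encode w"
  by (simp add: encode_list_def map_idI)

lemma encode_expr_list: "encode \<beta> = list_encode (map enc_expr \<beta>)"
  by (simp add: encode_list_def encode_expr_def)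

text \<open>Outside \<open>D\<close> the witness \<open>g\<close> may diverge or return anything.
  The domain thus carries the preconditions under which partial steps, such as \<open>hd\<close> or
  a given decision procedure, are called.\<close>

definition computable_on :: "'a::encodable set \<Rightarrow> ('a \<Rightarrow> 'b::encodable) \<Rightarrow> bool" where
  "computable_on D f \<longleftrightarrow> (\<exists>g. partrec g \<and> (\<forall>x\<in>D. g (encode x) = Some (encode (f x))))"

named_theorems computable

lemma computable_on_subset: "computable_on E f \<Longrightarrow> D \<subseteq> E \<Longrightarrow> computable_on D f"
  unfolding computable_on_def by blast

lemma computable_on_cong:
  assumes "computable_on D f" and "\<And>x. x \<in> D \<Longrightarrow> f x = g x"
  shows "computable_on D g"
  using assms unfolding computable_on_def by metis

lemma computable_on_encode_iff: "computable_on D (\<lambda>x. encode (f x)) \<longleftrightarrow> computable_on D f"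
  unfolding computable_on_def by simp

text \<open>Computability depends on codes alone, so a value may change its type as long as its code
  stays the same. Arithmetic on codes thus yields Boolean values, lists and trees.\<close>

lemma computable_on_same_code:
  assumes "computable_on D f" and "\<And>x. x \<in> D \<Longrightarrow> encode (g x) = encode (f x)"
  shows "computable_on D g"
  using assms unfolding computable_on_def by metis

section \<open>Closure under composition, pairing, recursion and search\<close>

lemma partrec_id: "partrec Some"
proof -
  have "pair_fn (\<lambda>x. Some (fst (prod_decode x))) (\<lambda>x. Some (snd (prod_decode x))) = Some"
    by (rule ext) (simp add: pair_fn_def)
  then show ?thesis
    using partrec.pair[OF partrec.left partrec.right] by simp
qed

lemma partrec_const: "partrec (\<lambda>_. Some c)"
proof (induction c)
  case 0
  show ?case by (rule partrec.zero)
next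
  case (Suc c)
  have "(\<lambda>x. Some (Suc x)) \<circ>\<^sub>m (\<lambda>_. Some c) = (\<lambda>_::nat. Some (Suc c))"
    by (rule ext) (simp add: map_comp_def)
  then show ?case
    using partrec.comp[OF partrec.succ Suc.IH] by simp
qed

lemma computable_on_id [computable]: "computable_on D (\<lambda>x. x)"
  unfolding computable_on_def using partrec_id by blast

lemma computable_on_const: "computable_on D (\<lambda>_. c)"
  unfolding computable_on_def using partrec_const by blast

lemma computable_on_comp:
  assumes "computable_on E g" and "computable_on D f" and "\<And>x. x \<in> D \<Longrightarrow> f x \<in> E"
  shows "computable_on D (\<lambda>x. g (f x))"
proof -
  obtain G F where "partrec G" "\<And>x. x \<in> E \<Longrightarrow> G (encode x) = Some (encode (g x))"
    and "partrec F" "\<And>x. x \<in> D \<Longrightarrow> F (encode x) = Some (encode (f x))"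
    using assms(1,2) unfolding computable_on_def by blast
  then have "partrec (G \<circ>\<^sub>m F)" "\<forall>x\<in>D. (G \<circ>\<^sub>m F) (encode x) = Some (encode (g (f x)))"
    using assms(3) by (auto intro: partrec.comp)
  then show ?thesis
    unfolding computable_on_def by blast
qed

lemma computable_on_partrec:
  assumes "partrec F" and "computable_on D f" and "\<And>x. x \<in> D \<Longrightarrow> F (encode (f x)) = Some (encode (g x))"
  shows "computable_on D g"
proof -
  obtain G where "partrec G" "\<And>x. x \<in> D \<Longrightarrow> G (encode x) = Some (encode (f x))"
    using assms(2) unfolding computable_on_def by blast
  then have "partrec (F \<circ>\<^sub>m G)" "\<forall>x\<in>D. (F \<circ>\<^sub>m G) (encode x) = Some (encode (g x))"
    using assms(1,3) by (auto intro: partrec.comp)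
  then show ?thesis
    unfolding computable_on_def by blast
qed

lemma computable_on_Pair [computable]:
  assumes "computable_on D f" and "computable_on D g"
  shows "computable_on D (\<lambda>x. (f x, g x))"
proof -
  obtain F G where "partrec F" "\<And>x. x \<in> D \<Longrightarrow> F (encode x) = Some (encode (f x))"
    and "partrec G" "\<And>x. x \<in> D \<Longrightarrow> G (encode x) = Some (encode (g x))"
    using assms unfolding computable_on_def by blast
  then have "partrec (pair_fn F G)"
    "\<forall>x\<in>D. pair_fn F G (encode x) = Some (encode (f x, g x))"
    by (simp_all add: partrec.pair pair_fn_def)
  then show ?thesis
    unfolding computable_on_def by blast
qed

lemma computable_on_fst [computable]: "computable_on D f \<Longrightarrow> computable_on D (\<lambda>x. fst (f x))"
  by (rule computable_on_partrec[OF partrec.left]) (auto simp: encode_prod_def)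

lemma computable_on_snd [computable]: "computable_on D f \<Longrightarrow> computable_on D (\<lambda>x. snd (f x))"
  by (rule computable_on_partrec[OF partrec.right]) (auto simp: encode_prod_def)

lemma computable_on_Suc [computable]: "computable_on D f \<Longrightarrow> computable_on D (\<lambda>x. Suc (f x))"
  by (rule computable_on_partrec[OF partrec.succ]) auto

lemma computable_on_encode [computable]: "computable_on D f \<Longrightarrow> computable_on D (\<lambda>x. encode (f x))"
  by (simp add: computable_on_encode_iff)

text \<open>The code of a pair of numbers is its Cantor number, so passing between the two does
  nothing to codes.\<close>

lemma computable_on_prod_encode [computable]:
  assumes "computable_on D f"
  shows "computable_on D (\<lambda>x. prod_encode (f x))"
  by (rule computable_on_same_code[OF assms]) (simp add: encode_prod_def)

lemma computable_on_prod_decode [computable]: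
  assumes "computable_on D f"
  shows "computable_on D (\<lambda>x. prod_decode (f x))"
  by (rule computable_on_same_code[OF assms]) (simp add: encode_prod_def)

text \<open>The step has to be computable only at states that the recursion reaches before its
  bound. Invariants of the iteration can therefore discharge preconditions of the step.\<close>

lemma computable_on_rec_nat [computable]:
  assumes f: "computable_on D f" and m: "computable_on D m"
    and g: "computable_on {p. fst p \<in> D \<and> fst (snd p) < m (fst p) \<and>
              snd (snd p) = rec_nat (f (fst p)) (g (fst p)) (fst (snd p))}
            (\<lambda>p. g (fst p) (fst (snd p)) (snd (snd p)))"
  shows "computable_on D (\<lambda>x. rec_nat (f x) (g x) (m x))"
proof -
  obtain F M G where F: "partrec F" "\<And>x. x \<in> D \<Longrightarrow> F (encode x) = Some (encode (f x))"
    and M: "partrec M" "\<And>x. x \<in> D \<Longrightarrow> M (encode x) = Some (m x)"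
    and G: "partrec G" "\<And>x k. x \<in> D \<Longrightarrow> k < m x \<Longrightarrow>
      G (prod_encode (encode x, prod_encode (k, encode (rec_nat (f x) (g x) k)))) =
        Some (encode (g x k (rec_nat (f x) (g x) k)))"
    using assms unfolding computable_on_def by (force simp: encode_prod_def)
  have *: "rec_nat (F (encode x))
      (\<lambda>k r. Option.bind r (\<lambda>y. G (prod_encode (encode x, prod_encode (k, y))))) k =
      Some (encode (rec_nat (f x) (g x) k))" if "x \<in> D" "k \<le> m x" for x k
    using that(2)
  proof (induction k)
    case 0
    show ?case by (simp add: F(2) that(1))
  next
    case (Suc k)
    then show ?case using G(2)[OF that(1), of k] by simp
  qed
  have "partrec (prim_rec F G \<circ>\<^sub>m pair_fn Some M)"
    by (intro partrec.comp partrec.prec partrec.pair F G M partrec_id)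
  moreover have "\<forall>x\<in>D. (prim_rec F G \<circ>\<^sub>m pair_fn Some M) (encode x) =
      Some (encode (rec_nat (f x) (g x) (m x)))"
    using * M(2) by (simp add: map_comp_def pair_fn_def prim_rec_def)
  ultimately show ?thesis
    unfolding computable_on_def by blast
qed

text \<open>The predicate enters negated because \<open>minimize\<close> looks for the value 0,
  which is the code of \<open>False\<close>. As the test converges everywhere on \<open>D\<close>,
  the search meets no divergence before the first hit.\<close>

lemma computable_on_Least:
  assumes P: "computable_on {p. fst p \<in> D} (\<lambda>p. \<not> P (fst p) (snd p))"
    and ex: "\<And>x. x \<in> D \<Longrightarrow> \<exists>m. P x m"
  shows "computable_on D (\<lambda>x. LEAST m. P x (m::nat))"
proof -
  obtain F where F: "partrec F"
    "\<And>x m. x \<in> D \<Longrightarrow> F (prod_encode (encode x, m)) = Some (encode (\<not> P x m))"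
    using P unfolding computable_on_def by (force simp: encode_prod_def)
  then have F': "F (prod_encode (encode x, m)) = Some 0 \<longleftrightarrow> P x m" if "x \<in> D" for x m
    using that by (simp add: encode_bool_def)
  have "minimize F (encode x) = Some (encode (LEAST m. P x m))" if "x \<in> D" for x
    using ex[OF that] F(2)[OF that] unfolding minimize_def F'[OF that] by simp
  then show ?thesis
    unfolding computable_on_def using partrec.mu[OF F(1)] by blast
qed

section \<open>Arithmetic, comparisons and conditionals\<close>

lemma computable_on_add [computable]:
  assumes "computable_on D f" and "computable_on D g"
  shows "computable_on D (\<lambda>x. f x + (g x :: nat))"
proof -
  have "a + b = rec_nat a (\<lambda>_ y. Suc y) b" for a b :: nat
    by (induction b) auto
  moreover have "computable_on D (\<lambda>x. rec_nat (f x) (\<lambda>_ y. Suc y) (g x))"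
    by (intro computable assms)
  ultimately show ?thesis by simp
qed

lemma computable_on_diff [computable]:
  assumes "computable_on D f" and "computable_on D g"
  shows "computable_on D (\<lambda>x. f x - (g x :: nat))"
proof -
  \<comment> \<open>The recursion drops the previous value and returns the index, which is the
    predecessor, with 0 sent to 0.\<close>
  have pred: "y - 1 = rec_nat 0 (\<lambda>k _. k) y" for y :: nat
    by (cases y) auto
  have "a - b = rec_nat a (\<lambda>_ y. rec_nat 0 (\<lambda>k _. k) y) b" for a b :: nat
    by (induction b) (auto simp: pred[symmetric])
  moreover have "computable_on D (\<lambda>x. rec_nat (f x) (\<lambda>_ y. rec_nat 0 (\<lambda>k _. k) y) (g x))"
    by (intro computable computable_on_const assms)
  ultimately show ?thesis by simp
qed

lemma computable_on_le [computable]: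
  assumes "computable_on D f" and "computable_on D g"
  shows "computable_on D (\<lambda>x. f x \<le> (g x :: nat))"
  by (rule computable_on_same_code[of D "\<lambda>x. 1 - (f x - g x)"])
    (intro computable computable_on_const assms, simp add: encode_bool_def)

lemma computable_on_Not [computable]:
  assumes "computable_on D f"
  shows "computable_on D (\<lambda>x. \<not> f x)"
  by (rule computable_on_same_code[of D "\<lambda>x. 1 - encode (f x)"])
    (intro computable computable_on_const assms, simp add: encode_bool_def)

lemma computable_on_less [computable]:
  assumes "computable_on D f" and "computable_on D g"
  shows "computable_on D (\<lambda>x. f x < (g x :: nat))"
  unfolding not_le[symmetric] by (intro computable assms)

text \<open>Both branches may be undefined outside their case, so the conditional is realised by two
  recursions of length at most one, each of which calls its branch only when needed.\<close>
lemma computable_on_If [computable]: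
  assumes b: "computable_on D b"
    and f: "computable_on {x \<in> D. b x} f" and g: "computable_on {x \<in> D. \<not> b x} g"
  shows "computable_on D (\<lambda>x. if b x then f x else g x)"
proof -
  define u where "u = (\<lambda>x. rec_nat 0 (\<lambda>_ _. encode (f x)) (encode (b x)))"
  define v where "v = (\<lambda>x. rec_nat (u x) (\<lambda>_ _. encode (g x)) (encode (\<not> b x)))"
  have "computable_on D u"
    unfolding u_def
    by (intro computable_on_rec_nat computable_on_const computable_on_encode b
        computable_on_comp[OF f] computable) (auto simp: encode_bool_def split: if_splits)
  then have "computable_on D v"
    unfolding v_def
    by (intro computable_on_rec_nat computable_on_const computable_on_encode computable_on_Not b
        computable_on_comp[OF g] computable) (auto simp: encode_bool_def split: if_splits)
  then show ?thesis
    by (rule computable_on_same_code) (simp add: u_def v_def encode_bool_def)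
qed

lemma computable_on_max [computable]:
  assumes "computable_on D f" and "computable_on D g"
  shows "computable_on D (\<lambda>x. max (f x) (g x :: nat))"
  unfolding max_def
  by (intro computable assms computable_on_subset[OF assms(1)] computable_on_subset[OF assms(2)]) auto

lemma computable_on_conj [computable]:
  assumes "computable_on D f" and "computable_on {x \<in> D. f x} g"
  shows "computable_on D (\<lambda>x. f x \<and> g x)"
proof -
  have "(\<lambda>x. f x \<and> g x) = (\<lambda>x. if f x then g x else False)" by auto
  then show ?thesis
    by (simp only:) (intro computable computable_on_const assms)
qed

lemma computable_on_eq [computable]:
  assumes "computable_on D f" and "computable_on D g"
  shows "computable_on D (\<lambda>x. f x = (g x :: nat))"
  by (subst order.eq_iff) (intro computable computable_on_subset[OF assms(1)] computable_on_subset[OF assms(2)] assms; blast)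

section \<open>Operations on lists\<close>

lemma computable_on_Cons [computable]:
  assumes "computable_on D f" and "computable_on D g"
  shows "computable_on D (\<lambda>x. f x # g x)"
  by (rule computable_on_same_code[of D "\<lambda>x. Suc (prod_encode (encode (f x), encode (g x)))"])
    (simp_all add: computable assms)

lemma computable_on_tl [computable]:
  assumes "computable_on D f"
  shows "computable_on D (\<lambda>x. tl (f x))"
proof (rule computable_on_same_code[of D "\<lambda>x. snd (prod_decode (encode (f x) - 1))"])
  show "encode (tl (f x)) = encode (snd (prod_decode (encode (f x) - 1)))" for x
  proof (cases "f x")
    \<comment> \<open>The code of \<open>[]\<close> is 0; truncated subtraction keeps it at 0, which
      decodes to (0, 0), so the result is again the code of \<open>[]\<close>.\<close>
    case Nil
    then show ?thesis by (simp add: prod_decode_def prod_decode_aux.simps)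
  qed simp
qed (intro computable computable_on_const assms)

lemma computable_on_hd [computable]:
  assumes "computable_on D f" and "\<And>x. x \<in> D \<Longrightarrow> f x \<noteq> []"
  shows "computable_on D (\<lambda>x. hd (f x))"
proof (rule computable_on_same_code[of D "\<lambda>x. fst (prod_decode (encode (f x) - 1))"])
  show "encode (hd (f x)) = encode (fst (prod_decode (encode (f x) - 1)))" if "x \<in> D" for x
    using assms(2)[OF that] by (cases "f x") simp_all
qed (intro computable computable_on_const assms)

lemma computable_on_null [computable]:
  assumes "computable_on D f"
  shows "computable_on D (\<lambda>x. f x = [])"
proof (rule computable_on_cong[of D "\<lambda>x. encode (f x) = 0"])
  show "(encode (f x) = 0) = (f x = [])" for x
    by (cases "f x") simp_all
qed (intro computable computable_on_const assms)

text \<open>Each \<open>Cons\<close> raises the code by at least one. The code of a list is thus a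
  computable number of iterations that suffices for a loop over it.\<close>

lemma length_le_encode: "length l \<le> encode l"
proof (induction l)
  case (Cons a l)
  then show ?case
    using le_prod_encode_2[of "encode l" "encode a"] by simp
qed simp

text \<open>The loop state is the remaining list together with the accumulator. Once the list is
  used up the state no longer changes, so iterating \<open>encode (l x)\<close> times, possibly more
  than the length, is harmless.\<close>

lemma computable_on_fold [computable]:
  assumes l: "computable_on D l" and f: "computable_on D f"
    and g: "computable_on {p. fst p \<in> D \<and> fst (snd p) \<in> set (l (fst p))}
            (\<lambda>p. g (fst p) (fst (snd p)) (snd (snd p)))"
  shows "computable_on D (\<lambda>x. fold (g x) (l x) (f x))"
proof -
  define step where "step = (\<lambda>x (k::nat) s. (tl (fst s), if fst s = [] then snd s else g x (hd (fst s)) (snd s)))"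
  have state: "rec_nat (l x, f x) (step x) k = (drop k (l x), fold (g x) (take k (l x)) (f x))"
    for x k
  proof (induction k)
    case (Suc k)
    show ?case
    proof (cases "k < length (l x)")
      case True
      then show ?thesis
        using Suc by (simp add: step_def tl_drop drop_Suc hd_drop_conv_nth take_Suc_conv_app_nth)
    next
      case False
      then show ?thesis
        using Suc by (simp add: step_def)
    qed
  qed simp
  \<comment> \<open>By \<open>state\<close>, the head of a reached nonempty list is an element of
    \<open>l x\<close>, so the hypothesis on \<open>g\<close> covers every call.\<close>
  have "computable_on D (\<lambda>x. rec_nat (l x, f x) (step x) (encode (l x)))"
    unfolding step_def
    by (intro computable_on_rec_nat computable l f
       computable_on_comp[OF g, of _ "\<lambda>p. (fst p, hd (fst (snd (snd p))), snd (snd (snd p)))", simplified])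
     (auto simp: state[unfolded step_def] intro: in_set_dropD[OF hd_in_set] cong: if_cong)
  then have "computable_on D (\<lambda>x. snd (rec_nat (l x, f x) (step x) (encode (l x))))"
    by (rule computable)
  then show ?thesis
    by (simp add: state length_le_encode)
qed

lemma computable_on_rev [computable]:
  assumes "computable_on D l"
  shows "computable_on D (\<lambda>x. rev (l x))"
proof -
  have "rev l = fold (\<lambda>a b. a # b) l []" for l :: "'b list"
    by (simp add: fold_Cons_rev)
  then show ?thesis
    by (simp only:) (intro computable computable_on_const assms)
qed

lemma computable_on_foldr [computable]:
  assumes "computable_on D l" and "computable_on D f"
    and "computable_on {p. fst p \<in> D \<and> fst (snd p) \<in> set (l (fst p))}
          (\<lambda>p. g (fst p) (fst (snd p)) (snd (snd p)))"
  shows "computable_on D (\<lambda>x. foldr (g x) (l x) (f x))"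
  unfolding foldr_conv_fold by (intro computable assms) (simp add: assms)

lemma computable_on_append [computable]:
  assumes "computable_on D f" and "computable_on D g"
  shows "computable_on D (\<lambda>x. f x @ g x)"
proof -
  have "k @ l = foldr (\<lambda>a b. a # b) k l" for k l :: "'b list"
    by (induction k) auto
  then show ?thesis
    by (simp only:) (intro computable assms)
qed

lemma computable_on_concat [computable]:
  assumes "computable_on D l"
  shows "computable_on D (\<lambda>x. concat (l x))"
proof -
  have "concat l = foldr (\<lambda>a b. a @ b) l []" for l :: "'b list list"
    by (induction l) auto
  then show ?thesis
    by (simp only:) (intro computable computable_on_const assms)
qed

lemma computable_on_map [computable]:
  assumes "computable_on D l"
    and "computable_on {p. fst p \<in> D \<and> snd p \<in> set (l (fst p))} (\<lambda>p. g (fst p) (snd p))"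
  shows "computable_on D (\<lambda>x. map (g x) (l x))"
proof -
  have "map h k = foldr (\<lambda>a b. h a # b) k []" for k and h :: "'b \<Rightarrow> 'c"
    by (induction k) auto
  then show ?thesis
    by (simp only:) (intro computable computable_on_const assms(1)
       computable_on_comp[OF assms(2), of _ "\<lambda>p. (fst p, fst (snd p))", simplified]; auto)
qed

lemma computable_on_filter [computable]:
  assumes "computable_on D l"
    and "computable_on {p. fst p \<in> D \<and> snd p \<in> set (l (fst p))} (\<lambda>p. g (fst p) (snd p))"
  shows "computable_on D (\<lambda>x. filter (g x) (l x))"
proof -
  have "filter h k = foldr (\<lambda>a b. if h a then a # b else b) k []" for k and h :: "'b \<Rightarrow> bool"
    by (induction k) auto
  then show ?thesis
    by (simp only:) (intro computable computable_on_const assms(1)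
       computable_on_comp[OF assms(2), of _ "\<lambda>p. (fst p, fst (snd p))", simplified]; auto)
qed

lemma computable_on_length [computable]:
  assumes "computable_on D l"
  shows "computable_on D (\<lambda>x. length (l x))"
proof -
  have "length k = foldr (\<lambda>_. Suc) k 0" for k :: "'b list"
    by (induction k) auto
  then show ?thesis
    by (simp only:) (intro computable computable_on_const assms)
qed

lemma computable_on_sum_list [computable]:
  assumes "computable_on D l"
  shows "computable_on D (\<lambda>x. sum_list (l x :: nat list))"
proof -
  have "sum_list k = foldr (\<lambda>a b. a + b) k 0" for k :: "nat list"
    by (induction k) auto
  then show ?thesis
    by (simp only:) (intro computable computable_on_const assms)
qed

lemma computable_on_upt [computable]:
  assumes "computable_on D f"
  shows "computable_on D (\<lambda>x. [0..<f x])"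
proof -
  have "[0..<n] = rec_nat [] (\<lambda>k l. l @ [k]) n" for n
    by (induction n) auto
  then show ?thesis
    by (simp only:) (intro computable computable_on_const assms)
qed

lemma computable_on_n_lists [computable]:
  assumes "computable_on D n" and "computable_on D l"
  shows "computable_on D (\<lambda>x. List.n_lists (n x) (l x))"
proof -
  have "List.n_lists m k =
      rec_nat [[]] (\<lambda>_ r. concat (map (\<lambda>ys. map (\<lambda>y. y # ys) k) r)) m" for m and k :: "'b list"
    by (induction m) auto
  then show ?thesis
    by (simp only:) (intro computable computable_on_const assms(1) computable_on_comp[OF assms(2)]; simp)
qed

section \<open>Value semantics of schemes\<close>

text \<open>Counterpart of \<open>step\<close> in which variables hold elements of the structure
  instead of terms.\<close>

fun exec :: "'a struct \<Rightarrow> expr \<Rightarrow> (nat \<Rightarrow> 'a) \<Rightarrow> nat \<Rightarrow> 'a" where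
  "exec U (FunE j f ls) v = v(j := fun_interp U f (map v ls))"
| "exec U (PredE r ls) v = v"

fun run :: "'a struct \<Rightarrow> (nat \<Rightarrow> 'a) \<Rightarrow> tree \<Rightarrow> nat" where
  "run U v (Terminal t) = t"
| "run U v (FunNode j f ls G) = run U (exec U (FunE j f ls) v) G"
| "run U v (PredNode r ls G0 G1) = run U v (if pred_interp U r (map v ls) then G1 else G0)"

fun answers :: "'a struct \<Rightarrow> (nat \<Rightarrow> 'a) \<Rightarrow> expr list \<Rightarrow> bool list" where
  "answers U v [] = []"
| "answers U v (FunE j f ls # \<beta>) = answers U (exec U (FunE j f ls) v) \<beta>"
| "answers U v (PredE r ls # \<beta>) = pred_interp U r (map v ls) # answers U v \<beta>"

fun follows :: "'a struct \<Rightarrow> (nat \<Rightarrow> 'a) \<Rightarrow> (expr \<times> bool option) list \<Rightarrow> bool" where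
  "follows U v [] \<longleftrightarrow> True"
| "follows U v ((FunE j f ls, c) # p) \<longleftrightarrow> c = None \<and> follows U (exec U (FunE j f ls) v) p"
| "follows U v ((PredE r ls, c) # p) \<longleftrightarrow> c = Some (pred_interp U r (map v ls)) \<and> follows U v p"

fun run_path :: "'a struct \<Rightarrow> (nat \<Rightarrow> 'a) \<Rightarrow> tree \<Rightarrow> path" where
  "run_path U v (Terminal t) = ([], t)"
| "run_path U v (FunNode j f ls G) =
     apfst (Cons (FunE j f ls, None)) (run_path U (exec U (FunE j f ls) v) G)"
| "run_path U v (PredNode r ls G0 G1) =
     (let b = pred_interp U r (map v ls)
      in apfst (Cons (PredE r ls, Some b)) (run_path U v (if b then G1 else G0)))"

text \<open>The values of the initial terms: from index \<open>n - 1\<close> on, every variable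
  holds the last argument.\<close>

abbreviation input :: "nat \<Rightarrow> 'a list \<Rightarrow> nat \<Rightarrow> 'a" where
  "input n a \<equiv> \<lambda>j. a ! min j (n - 1)"

section \<open>Agreement of formula semantics and value semantics\<close>

lemma snd_run_path: "snd (run_path U v G) = run U v G"
  by (induction G arbitrary: v) (auto simp: Let_def)

lemma Cons_path_eq_apfst: "(\<lambda>(p, t). (x # p, t)) = apfst (Cons x)"
  by auto

text \<open>At a predicate node exactly one outgoing edge carries the actual truth value. The
  equivalence packs existence and uniqueness of the followed path together and so resolves the
  definite description in \<open>tree_fun\<close>.\<close>

lemma complete_path_followed_iff:
  "\<tau> \<in> complete_paths G \<and> follows U v (fst \<tau>) \<longleftrightarrow> \<tau> = run_path U v G"
proof (induction G arbitrary: \<tau> v)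
  case (Terminal t)
  show ?case by auto
next
  case (FunNode j f ls G)
  have "\<tau> \<in> complete_paths (FunNode j f ls G) \<and> follows U v (fst \<tau>) \<longleftrightarrow>
      (\<exists>\<tau>'. \<tau> = apfst (Cons (FunE j f ls, None)) \<tau>' \<and>
        \<tau>' \<in> complete_paths G \<and> follows U (exec U (FunE j f ls) v) (fst \<tau>'))"
    by (auto simp: Cons_path_eq_apfst intro: rev_image_eqI simp del: exec.simps)
  then show ?case
    by (simp add: FunNode del: complete_paths.simps exec.simps split_paired_Ex)
next
  case (PredNode r ls G0 G1)
  define b where "b = pred_interp U r (map v ls)"
  have "\<tau> \<in> complete_paths (PredNode r ls G0 G1) \<and> follows U v (fst \<tau>) \<longleftrightarrow>
      (\<exists>\<tau>'. \<tau> = apfst (Cons (PredE r ls, Some b)) \<tau>' \<and>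
        \<tau>' \<in> complete_paths (if b then G1 else G0) \<and> follows U v (fst \<tau>'))"
    by (cases b) (auto simp: Cons_path_eq_apfst b_def intro: rev_image_eqI)
  then show ?case
    by (cases b) (simp_all add: PredNode b_def[symmetric] del: complete_paths.simps split_paired_Ex)
qed

text \<open>\<open>path_formulas\<close> inspects the edge labels, \<open>follows\<close> the
  expressions; this lets one be translated into the other.\<close>

lemma complete_paths_labels:
  "\<forall>\<tau>\<in>complete_paths G. \<forall>x\<in>set (fst \<tau>). is_pred (fst x) \<longleftrightarrow> snd x \<noteq> None"
  by (induction G) (simp_all add: Cons_path_eq_apfst ball_Un del: not_None_eq)

lemma eval_step: "(\<lambda>j. eval_tm U e (step b M j)) = exec U b (\<lambda>j. eval_tm U e (M j))"
  by (cases b) (auto simp: fun_eq_iff comp_def)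

text \<open>Generalises \<open>kappa\<close> to an arbitrary initial term sequence, so that an
  induction can remove the first expression and absorb its effect into \<open>M\<close>.\<close>

definition kappa_from :: "(nat \<Rightarrow> tm) \<Rightarrow> expr list \<Rightarrow> nat \<Rightarrow> fm" where
  "kappa_from M \<beta> i =
     (case \<beta> ! i of PredE r ls \<Rightarrow> Atom r (map (fold step (take i \<beta>) M) ls) | _ \<Rightarrow> undefined)"

lemma kappa_from_Cons [simp]:
  "kappa_from M (PredE r ls # \<beta>) 0 = Atom r (map M ls)"
  "kappa_from M (b # \<beta>) (Suc i) = kappa_from (step b M) \<beta> i"
  by (simp_all add: kappa_from_def cong: expr.case_cong)

lemma term_seq_eq_fold:
  "i \<le> length \<beta> \<Longrightarrow> term_seq n \<beta> i = fold step (take i \<beta>) (\<lambda>j. Var (min j (n - 1)))"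
  by (induction i) (simp_all add: take_Suc_conv_app_nth)

lemma kappa_eq_kappa_from:
  "i < length \<beta> \<Longrightarrow> kappa n \<beta> i = kappa_from (\<lambda>j. Var (min j (n - 1))) \<beta> i"
  by (simp add: kappa_def kappa_from_def term_seq_eq_fold split: expr.split)

text \<open>Induction along the path with \<open>M\<close> arbitrary: \<open>step\<close> moves the
  first expression into \<open>M\<close>, and \<open>eval_step\<close> turns this symbolic update
  into \<open>exec\<close>.\<close>

lemma follows_iff_sat:
  assumes "\<forall>x\<in>set p. is_pred (fst x) \<longleftrightarrow> snd x \<noteq> None"
  shows "(\<forall>i<length p. \<forall>c. snd (p ! i) = Some c \<longrightarrow>
            sat U e (literal (kappa_from M (map fst p) i) c)) \<longleftrightarrow>
         follows U (\<lambda>j. eval_tm U e (M j)) p"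
  using assms
proof (induction p arbitrary: M)
  case (Cons bc p)
  obtain b c where [simp]: "bc = (b, c)" by (cases bc)
  show ?case
  proof (cases b)
    case (FunE j f ls)
    then have "c = None"
      using Cons.prems by auto
    then show ?thesis
      using Cons.IH[of "step b M"] Cons.prems FunE
      by (simp add: All_less_Suc2 eval_step del: step.simps exec.simps)
  next
    case (PredE r ls)
    then obtain d where "c = Some d"
      using Cons.prems by auto
    moreover have "sat U e (literal (Atom r (map M ls)) d) \<longleftrightarrow>
        d = pred_interp U r (map (\<lambda>j. eval_tm U e (M j)) ls)"
      by (cases d) (simp_all add: literal_def comp_def)
    moreover have "(\<forall>i<length p. \<forall>c. snd (p ! i) = Some c \<longrightarrow>
        sat U e (literal (kappa_from M (map fst p) i) c)) \<longleftrightarrow>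
        follows U (\<lambda>j. eval_tm U e (M j)) p"
      by (rule Cons.IH) (use Cons.prems in auto)
    ultimately show ?thesis
      by (simp add: PredE All_less_Suc2)
  qed
qed simp

lemma tree_fun_eq_run: "tree_fun (n, G) U a = run U (input n a) G"
proof -
  have "(\<forall>p\<in>path_formulas n \<tau>. sat U (\<lambda>i. a ! i) p) \<longleftrightarrow> follows U (input n a) (fst \<tau>)"
    if "\<tau> \<in> complete_paths G" for \<tau>
  proof -
    have "(\<forall>p\<in>path_formulas n \<tau>. sat U (\<lambda>i. a ! i) p) \<longleftrightarrow>
        (\<forall>i<length (fst \<tau>). \<forall>c. snd (fst \<tau> ! i) = Some c \<longrightarrow>
            sat U (\<lambda>i. a ! i) (literal (kappa n (map fst (fst \<tau>)) i) c))"
      unfolding path_formulas_def path_exprs_def by blast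
    also have "\<dots> \<longleftrightarrow> (\<forall>i<length (fst \<tau>). \<forall>c. snd (fst \<tau> ! i) = Some c \<longrightarrow>
            sat U (\<lambda>i. a ! i) (literal (kappa_from (\<lambda>j. Var (min j (n - 1))) (map fst (fst \<tau>)) i) c))"
      by (simp add: kappa_eq_kappa_from)
    also have "\<dots> \<longleftrightarrow> follows U (input n a) (fst \<tau>)"
      using follows_iff_sat[OF bspec[OF complete_paths_labels that], of U "\<lambda>i. a ! i" "\<lambda>j. Var (min j (n - 1))"]
      by simp
    finally show ?thesis .
  qed
  then have "\<tau> \<in> complete_paths G \<and> (\<forall>p\<in>path_formulas n \<tau>. sat U (\<lambda>i. a ! i) p) \<longleftrightarrow>
      \<tau> = run_path U (input n a) G" for \<tau>
    using complete_path_followed_iff[of \<tau> G U "input n a"] by blast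
  then show ?thesis
    by (simp add: tree_fun_def snd_run_path)
qed

lemma pred_positions_Cons:
  "pred_positions (b # \<beta>) = (if is_pred b then [0] else []) @ map Suc (pred_positions \<beta>)"
proof -
  have "[0..<length (b # \<beta>)] = 0 # map Suc [0..<length \<beta>]"
    by (simp add: upt_conv_Cons map_Suc_upt del: upt_Suc)
  then show ?thesis
    by (simp add: pred_positions_def filter_map comp_def)
qed

lemma answers_eq_sat:
  "map (\<lambda>i. sat U e (kappa_from M \<beta> i)) (pred_positions \<beta>) =
     answers U (\<lambda>j. eval_tm U e (M j)) \<beta>"
proof (induction \<beta> arbitrary: M)
  case Nil
  show ?case by (simp add: pred_positions_def)
next
  case (Cons b \<beta>)
  show ?case
    using Cons.IH[of "step b M"]
    by (cases b) (simp_all add: pred_positions_Cons comp_def eval_step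
        del: step.simps(1) exec.simps(1))
qed

lemma probl_fun_eq_answers: "probl_fun (n, \<nu>, \<beta>) U a = \<nu> (answers U (input n a) \<beta>)"
proof -
  have "map (\<lambda>i. sat U (\<lambda>j. a ! j) (kappa n \<beta> i)) (pred_positions \<beta>) =
      map (\<lambda>i. sat U (\<lambda>j. a ! j) (kappa_from (\<lambda>j. Var (min j (n - 1))) \<beta> i)) (pred_positions \<beta>)"
    by (auto simp: pred_positions_def kappa_eq_kappa_from)
  then show ?thesis
    by (simp add: probl_fun_def answers_eq_sat)
qed

lemma length_answers: "length (answers U v \<beta>) = length (pred_positions \<beta>)"
proof (induction \<beta> arbitrary: v)
  case Nil
  show ?case by (simp add: pred_positions_def)
next
  case (Cons b \<beta>)
  then show ?case by (cases b) (simp_all add: pred_positions_Cons)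
qed

text \<open>All later arguments about solutions use this form, in which terms and paths no longer
  occur.\<close>

lemma solves_iff_run:
  "solves (n, G) (m, \<nu>, \<beta>) D \<longleftrightarrow> n = m \<and>
     (\<forall>U\<in>D. \<forall>a\<in>tuples U m. run U (input n a) G = \<nu> (answers U (input n a) \<beta>))"
  by (auto simp: solves_def tree_fun_eq_run probl_fun_eq_answers)

section \<open>Words, depth and variables of trees\<close>

text \<open>A list instead of a set, so that the words of a tree can be part of computed
  data.\<close>

fun tree_words :: "tree \<Rightarrow> nat list list" where
  "tree_words (Terminal t) = [[]]"
| "tree_words (FunNode j f ls G) = map (Cons f) (tree_words G)"
| "tree_words (PredNode r ls G0 G1) = map (Cons r) (tree_words G0 @ tree_words G1)"

fun depth :: "tree \<Rightarrow> nat" where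
  "depth (Terminal t) = 0"
| "depth (FunNode j f ls G) = Suc (depth G)"
| "depth (PredNode r ls G0 G1) = Suc (max (depth G0) (depth G1))"

fun tree_vars :: "tree \<Rightarrow> nat set" where
  "tree_vars (Terminal t) = {}"
| "tree_vars (FunNode j f ls G) = insert j (set ls \<union> tree_vars G)"
| "tree_vars (PredNode r ls G0 G1) = set ls \<union> tree_vars G0 \<union> tree_vars G1"

fun labels :: "tree \<Rightarrow> nat set" where
  "labels (Terminal t) = {t}"
| "labels (FunNode j f ls G) = labels G"
| "labels (PredNode r ls G0 G1) = labels G0 \<union> labels G1"

fun rename :: "(nat \<Rightarrow> nat) \<Rightarrow> (nat \<Rightarrow> nat) \<Rightarrow> tree \<Rightarrow> tree" where
  "rename \<pi> \<rho> (Terminal t) = Terminal (\<rho> t)"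
| "rename \<pi> \<rho> (FunNode j f ls G) = FunNode (\<pi> j) f (map \<pi> ls) (rename \<pi> \<rho> G)"
| "rename \<pi> \<rho> (PredNode r ls G0 G1) = PredNode r (map \<pi> ls) (rename \<pi> \<rho> G0) (rename \<pi> \<rho> G1)"

definition tree_symbols :: "tree \<Rightarrow> nat set" where
  "tree_symbols G = \<Union> (set ` set (tree_words G))"

lemma tree_words_nonempty: "tree_words G \<noteq> []"
  by (induction G) auto

text \<open>The symbol at the root is visible only through words, which is why
  \<open>tree_words_nonempty\<close> is used.\<close>

lemma tree_symbols_simps [simp]:
  "tree_symbols (Terminal t) = {}"
  "tree_symbols (FunNode j f ls G) = insert f (tree_symbols G)"
  "tree_symbols (PredNode r ls G0 G1) = insert r (tree_symbols G0 \<union> tree_symbols G1)"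
  using tree_words_nonempty[of G] tree_words_nonempty[of G0]
  by (auto simp: tree_symbols_def neq_Nil_conv)

lemma set_tree_words: "set (tree_words G) = (\<lambda>\<tau>. word (path_exprs \<tau>)) ` complete_paths G"
  by (induction G) (simp_all add: word_def path_exprs_def image_Un image_image Cons_path_eq_apfst)

lemma tree_complexity_eq: "tree_complexity \<psi> (n, G) = Max (\<psi> ` set (tree_words G))"
  by (simp add: tree_complexity_def set_tree_words image_image)

lemma tree_symbols_subset: "wf_tree \<sigma> G \<Longrightarrow> tree_symbols G \<subseteq> symbols \<sigma>"
  by (induction G) (auto simp: fun_symbol_def pred_symbol_def)

lemma tree_words_in_lists: "wf_tree \<sigma> G \<Longrightarrow> set (tree_words G) \<subseteq> lists (symbols \<sigma>)"
  using tree_symbols_subset[of \<sigma> G] by (auto simp: tree_symbols_def)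

lemma depth_attained: "\<exists>w\<in>set (tree_words G). length w = depth G"
proof (induction G)
  case (PredNode r ls G0 G1)
  then obtain w0 w1 where "w0 \<in> set (tree_words G0)" "length w0 = depth G0"
    "w1 \<in> set (tree_words G1)" "length w1 = depth G1"
    by blast
  then show ?case
    by (intro bexI[of _ "r # (if depth G0 \<le> depth G1 then w1 else w0)"]) auto
qed auto

lemma finite_tree_vars: "finite (tree_vars G)"
  by (induction G) auto

text \<open>Bounds the variables of a tree of depth at most \<open>d\<close> with arities at most
  \<open>A\<close>: the root contributes up to \<open>A\<close> arguments and one assigned variable,
  and there are at most two subtrees.\<close>

primrec var_bound :: "nat \<Rightarrow> nat \<Rightarrow> nat" where
  "var_bound A 0 = 0"
| "var_bound A (Suc d) = Suc A + 2 * var_bound A d"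

lemma card_tree_vars:
  assumes "depth G \<le> d" and "wf_tree \<sigma> G" and "\<And>q. q \<in> tree_symbols G \<Longrightarrow> arity \<sigma> q \<le> A"
  shows "card (tree_vars G) \<le> var_bound A d"
  using assms
proof (induction G arbitrary: d)
  case (FunNode j f ls G)
  then obtain d' where [simp]: "d = Suc d'" by (cases d) auto
  have "card (insert j (set ls \<union> tree_vars G)) \<le> Suc (card (set ls) + card (tree_vars G))"
    using card_Un_le[of "set ls" "tree_vars G"] by (simp add: card_insert_if finite_tree_vars)
  moreover have "card (set ls) \<le> A"
    using FunNode.prems(2) FunNode.prems(3)[of f] card_length[of ls] by simp
  moreover have "card (tree_vars G) \<le> var_bound A d'"
    using FunNode by auto
  ultimately show ?case by simp
next
  case (PredNode r ls G0 G1)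
  then obtain d' where [simp]: "d = Suc d'" by (cases d) auto
  have "card (set ls \<union> tree_vars G0 \<union> tree_vars G1) \<le>
      card (set ls) + card (tree_vars G0) + card (tree_vars G1)"
    by (meson add_le_mono1 card_Un_le le_trans)
  moreover have "card (set ls) \<le> A"
    using PredNode.prems(2) PredNode.prems(3)[of r] card_length[of ls] by simp
  moreover have "card (tree_vars G0) \<le> var_bound A d'" "card (tree_vars G1) \<le> var_bound A d'"
    using PredNode by auto
  ultimately show ?case by simp
qed simp

section \<open>Renaming of variables and terminal labels\<close>

lemma tree_words_rename [simp]: "tree_words (rename \<pi> \<rho> G) = tree_words G"
  by (induction G) auto

lemma wf_tree_rename [simp]: "wf_tree \<sigma> (rename \<pi> \<rho> G) \<longleftrightarrow> wf_tree \<sigma> G"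
  by (induction G) auto

lemma tree_vars_rename: "tree_vars (rename \<pi> \<rho> G) = \<pi> ` tree_vars G"
  by (induction G) auto

lemma labels_rename: "labels (rename \<pi> \<rho> G) = \<rho> ` labels G"
  by (induction G) auto

text \<open>The invariant is that \<open>v'\<close> read through \<open>\<pi>\<close> agrees with
  \<open>v\<close> on \<open>X\<close>. Injectivity preserves it: an assignment to
  \<open>\<pi> j\<close> overwrites no other renamed variable. The set \<open>X\<close> stays fixed
  while the induction descends into subtrees.\<close>

lemma run_rename:
  assumes "inj_on \<pi> X" and "tree_vars G \<subseteq> X" and "\<And>i. i \<in> X \<Longrightarrow> v' (\<pi> i) = v i"
  shows "run U v' (rename \<pi> \<rho> G) = \<rho> (run U v G)"
  using assms(2,3)
proof (induction G arbitrary: v v')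
  case (FunNode j f ls G)
  have args: "map (v' \<circ> \<pi>) ls = map v ls"
    using FunNode.prems by auto
  have "exec U (FunE (\<pi> j) f (map \<pi> ls)) v' (\<pi> i) = exec U (FunE j f ls) v i" if "i \<in> X" for i
    using that FunNode.prems assms(1) by (auto simp: args dest: inj_onD)
  then show ?case
    using FunNode by (simp del: exec.simps)
next
  case (PredNode r ls G0 G1)
  have args: "map (v' \<circ> \<pi>) ls = map v ls"
    using PredNode.prems by auto
  show ?case
    using PredNode by (simp add: args)
qed simp

text \<open>Variables below \<open>n\<close> keep their names; the others all start with the last
  argument, so they may be packed into indices from \<open>n\<close> on. On \<open>D\<close> a
  solution outputs only values of \<open>\<nu>\<close>, so changing the remaining labels does no
  harm.\<close>

lemma solution_with_bounded_variables:
  assumes wf: "wf_tree \<sigma> G" and n: "n \<ge> 1" and sol: "solves (n, G) (n, \<nu>, \<beta>) D"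
    and depth: "depth G \<le> N" and arity: "\<And>q. q \<in> tree_symbols G \<Longrightarrow> arity \<sigma> q \<le> A"
    and L: "L = \<nu> ` {bs. length bs = length (pred_positions \<beta>)}"
  obtains G' where "wf_tree \<sigma> G'" and "tree_words G' = tree_words G"
    and "tree_vars G' \<subseteq> {..<n + var_bound A N}" and "labels G' \<subseteq> L"
    and "solves (n, G') (n, \<nu>, \<beta>) D"
proof -
  \<comment> \<open>\<open>L\<close> is nonempty, so a replacement for foreign labels
    exists.\<close>
  obtain l where l: "l \<in> L"
    using Ex_list_of_length unfolding L by blast
  define \<rho> where "\<rho> t = (if t \<in> L then t else l)" for t
  obtain h where h: "bij_betw h (tree_vars G) {0..<card (tree_vars G)}"
    using ex_bij_betw_finite_nat[OF finite_tree_vars] by blast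
  define \<pi> where "\<pi> i = (if i < n then i else n + h i)" for i
  have inj: "inj_on \<pi> (tree_vars G)"
    using bij_betw_imp_inj_on[OF h] by (auto simp: inj_on_def \<pi>_def)
  have "\<pi> i < n + var_bound A N" if "i \<in> tree_vars G" for i
    using bij_betwE[OF h] that card_tree_vars[OF depth wf arity] by (fastforce simp: \<pi>_def)
  then have vars: "tree_vars (rename \<pi> \<rho> G) \<subseteq> {..<n + var_bound A N}"
    by (auto simp: tree_vars_rename)
  have "run U (input n a) (rename \<pi> \<rho> G) = \<rho> (run U (input n a) G)" for U :: "'a struct" and a
    using n by (intro run_rename[OF inj]) (auto simp: \<pi>_def min_def)
  moreover have "\<rho> (\<nu> (answers U v \<beta>)) = \<nu> (answers U v \<beta>)" for U :: "'a struct" and v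
    by (auto simp: \<rho>_def L length_answers)
  ultimately have "solves (n, rename \<pi> \<rho> G) (n, \<nu>, \<beta>) D"
    using sol by (auto simp: solves_iff_run)
  moreover have "labels (rename \<pi> \<rho> G) \<subseteq> L"
    using l by (auto simp: labels_rename \<rho>_def)
  ultimately show ?thesis
    using that[of "rename \<pi> \<rho> G"] wf vars by simp
qed

text \<open>Both branches of a predicate node continue with the same expressions, so every complete
  path spells \<open>word \<beta>\<close>; the answers are fed into \<open>\<nu>\<close> one at a
  time.\<close>

fun decision_tree :: "(bool list \<Rightarrow> nat) \<Rightarrow> expr list \<Rightarrow> tree" where
  "decision_tree \<nu> [] = Terminal (\<nu> [])"
| "decision_tree \<nu> (FunE j f ls # \<beta>) = FunNode j f ls (decision_tree \<nu> \<beta>)"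
| "decision_tree \<nu> (PredE r ls # \<beta>) =
     PredNode r ls (decision_tree (\<lambda>bs. \<nu> (False # bs)) \<beta>) (decision_tree (\<lambda>bs. \<nu> (True # bs)) \<beta>)"

lemma run_decision_tree: "run U v (decision_tree \<nu> \<beta>) = \<nu> (answers U v \<beta>)"
  by (induction \<nu> \<beta> arbitrary: v rule: decision_tree.induct) auto

lemma wf_decision_tree: "\<forall>b\<in>set \<beta>. wf_expr \<sigma> b \<Longrightarrow> wf_tree \<sigma> (decision_tree \<nu> \<beta>)"
  by (induction \<nu> \<beta> rule: decision_tree.induct) auto

lemma tree_words_decision_tree: "set (tree_words (decision_tree \<nu> \<beta>)) = {word \<beta>}"
  by (induction \<nu> \<beta> rule: decision_tree.induct) (auto simp: word_def)

lemma solves_decision_tree: "solves (n, decision_tree \<nu> \<beta>) (n, \<nu>, \<beta>) D"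
  by (simp add: solves_iff_run run_decision_tree)

section \<open>Strictly limited measures\<close>

lemma strictly_limitedD:
  assumes "strictly_limited \<sigma> \<psi>" and "u \<in> lists (symbols \<sigma>)" "v \<in> lists (symbols \<sigma>)"
    and "w \<in> lists (symbols \<sigma>)" and "v \<noteq> []"
  shows "\<psi> (u @ w) < \<psi> (u @ v @ w)"
  using assms unfolding strictly_limited_def by blast

text \<open>Deleting the letters one by one lowers the measure by at least one each time.\<close>

lemma length_le_measure:
  assumes "strictly_limited \<sigma> \<psi>" and "w \<in> lists (symbols \<sigma>)"
  shows "length w \<le> \<psi> w"
  using assms(2)
proof (induction w)
  case (Cons a w)
  then show ?case
    using strictly_limitedD[OF assms(1), of "[]" "[a]" w] by auto
qed simp

text \<open>First the part after \<open>q\<close> is deleted, then the part before it. The case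
  distinctions arise because only nonempty deletions lower the measure.\<close>

lemma symbol_measure_le:
  assumes "strictly_limited \<sigma> \<psi>" and "w \<in> lists (symbols \<sigma>)" and "q \<in> set w"
  shows "\<psi> [q] \<le> \<psi> w"
proof -
  obtain u v where w: "w = u @ q # v"
    using split_list[OF assms(3)] by blast
  have "\<psi> [q] \<le> \<psi> (q # v)"
    using strictly_limitedD[OF assms(1), of "[q]" v "[]"] assms(2) w by (cases "v = []") auto
  also have "\<dots> \<le> \<psi> w"
    using strictly_limitedD[OF assms(1), of "[]" u "q # v"] assms(2) w by (cases "u = []") auto
  finally show ?thesis .
qed

section \<open>Enumeration of bounded trees\<close>

lemma computable_on_Terminal [computable]:
  assumes "computable_on D t"
  shows "computable_on D (\<lambda>x. Terminal (t x))"
  by (rule computable_on_same_code[of D "\<lambda>x. prod_encode (0, t x)"])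
    (intro computable computable_on_const assms, simp add: encode_tree_def)

lemma computable_on_FunNode [computable]:
  assumes "computable_on D j" "computable_on D f" "computable_on D ls" "computable_on D G"
  shows "computable_on D (\<lambda>x. FunNode (j x) (f x) (ls x) (G x))"
  by (rule computable_on_same_code[of D "\<lambda>x. prod_encode (1, prod_encode (prod_encode (0,
        prod_encode (j x, prod_encode (f x, encode (ls x)))), encode (G x)))"])
    (intro computable computable_on_const assms, simp add: encode_tree_def encode_nat_list)

lemma computable_on_PredNode [computable]:
  assumes "computable_on D r" "computable_on D ls" "computable_on D G0" "computable_on D G1"
  shows "computable_on D (\<lambda>x. PredNode (r x) (ls x) (G0 x) (G1 x))"
  by (rule computable_on_same_code[of D "\<lambda>x. prod_encode (2, prod_encode (prod_encode (1,
        prod_encode (r x, encode (ls x))), prod_encode (encode (G0 x), encode (G1 x))))"])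
    (intro computable computable_on_const assms, simp add: encode_tree_def encode_nat_list)

lemma computable_on_symbol [computable]:
  assumes "computable_on D e"
  shows "computable_on D (\<lambda>x. symbol (e x))"
proof (rule computable_on_cong)
  \<comment> \<open>The tag decides where to look: in a function expression the assigned variable
    precedes the symbol, which therefore lies one pair deeper.\<close>
  show "computable_on D (\<lambda>x. let c = prod_decode (encode (e x))
      in if fst c = 0 then fst (prod_decode (snd (prod_decode (snd c))))
         else fst (prod_decode (snd c)))"
    unfolding Let_def
    by (intro computable computable_on_const assms computable_on_subset[OF assms]) auto
  show "(let c = prod_decode (encode (e x))
      in if fst c = 0 then fst (prod_decode (snd (prod_decode (snd c))))
         else fst (prod_decode (snd c))) = symbol (e x)" for x
    by (cases "e x") (simp_all add: encode_expr_def)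
qed

text \<open>Makes arity and measure total by a default value, so that later closure proofs need not
  track whether symbols and words belong to the signature.\<close>

lemma computable_on_if_domain:
  assumes "computable_on D f" and "computable_on UNIV (\<lambda>x. x \<in> D)"
  shows "computable_on UNIV (\<lambda>x. if x \<in> D then f x else c)"
  by (intro computable computable_on_const assms computable_on_subset[OF assms(1)]) auto

text \<open>Each tree comes with its list of words, which spares recursion over codes of trees.\<close>
definition pred_nodes ::
  "(tree \<times> nat list list) list \<Rightarrow> nat \<Rightarrow> nat list \<Rightarrow> (tree \<times> nat list list) list" where
  "pred_nodes cs q ls = concat (map (\<lambda>c0. map (\<lambda>c1.
     (PredNode q ls (fst c0) (fst c1), map (Cons q) (snd c0 @ snd c1))) cs) cs)"

definition fun_nodes ::
  "nat list \<Rightarrow> (tree \<times> nat list list) list \<Rightarrow> nat \<Rightarrow> nat list \<Rightarrow> (tree \<times> nat list list) list" where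
  "fun_nodes V cs q ls = concat (map (\<lambda>j. map (\<lambda>c.
     (FunNode j q ls (fst c), map (Cons q) (snd c))) cs) V)"

text \<open>\<open>Q\<close>, \<open>V\<close> and \<open>L\<close> supply symbols, variables and
  labels. Terminals are added at every step, so that \<open>d\<close> iterations give depth at most
  \<open>d\<close>, not only exactly \<open>d\<close>.\<close>

definition tree_step ::
  "(nat \<Rightarrow> bool) \<Rightarrow> (nat \<Rightarrow> nat) \<Rightarrow> nat list \<Rightarrow> nat list \<Rightarrow> nat list \<Rightarrow>
   (tree \<times> nat list list) list \<Rightarrow> (tree \<times> nat list list) list" where
  "tree_step P ar Q V L cs = map (\<lambda>t. (Terminal t, [[]])) L @
     concat (map (\<lambda>q. concat (map (\<lambda>ls. if P q then pred_nodes cs q ls else fun_nodes V cs q ls)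
       (List.n_lists (ar q) V))) Q)"

definition trees_upto ::
  "(nat \<Rightarrow> bool) \<Rightarrow> (nat \<Rightarrow> nat) \<Rightarrow> nat list \<Rightarrow> nat list \<Rightarrow> nat list \<Rightarrow> nat \<Rightarrow>
   (tree \<times> nat list list) list" where
  "trees_upto P ar Q V L d = rec_nat (map (\<lambda>t. (Terminal t, [[]])) L) (\<lambda>_. tree_step P ar Q V L) d"

lemma mem_pred_nodes:
  "(G, ws) \<in> set (pred_nodes cs q ls) \<longleftrightarrow> (\<exists>G0 ws0 G1 ws1. (G0, ws0) \<in> set cs \<and>
     (G1, ws1) \<in> set cs \<and> G = PredNode q ls G0 G1 \<and> ws = map (Cons q) (ws0 @ ws1))"
  unfolding pred_nodes_def by force

lemma mem_fun_nodes:
  "(G, ws) \<in> set (fun_nodes V cs q ls) \<longleftrightarrow> (\<exists>j G' ws'. j \<in> set V \<and> (G', ws') \<in> set cs \<and>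
     G = FunNode j q ls G' \<and> ws = map (Cons q) ws')"
  unfolding fun_nodes_def by force

lemma mem_tree_step:
  "(G, ws) \<in> set (tree_step P ar Q V L cs) \<longleftrightarrow>
     (\<exists>t\<in>set L. G = Terminal t \<and> ws = [[]]) \<or>
     (\<exists>q ls. q \<in> set Q \<and> length ls = ar q \<and> set ls \<subseteq> set V \<and>
        (G, ws) \<in> set (if P q then pred_nodes cs q ls else fun_nodes V cs q ls))"
proof -
  have "(G, ws) \<in> set (map (\<lambda>t. (Terminal t, [[]])) L) \<longleftrightarrow> (\<exists>t\<in>set L. G = Terminal t \<and> ws = [[]])"
    by auto
  moreover have "(G, ws) \<in> set (concat (map (\<lambda>q. concat (map (N q) (List.n_lists (ar q) V))) Q)) \<longleftrightarrow>
      (\<exists>q ls. q \<in> set Q \<and> length ls = ar q \<and> set ls \<subseteq> set V \<and> (G, ws) \<in> set (N q ls))" for N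
    by (auto simp: set_n_lists)
  ultimately show ?thesis
    unfolding tree_step_def set_append Un_iff by (simp only:)
qed

lemma trees_upto_sound:
  assumes "(G, ws) \<in> set (trees_upto (pred_symbol \<sigma>) ar Q V L d)"
    and "set Q \<subseteq> symbols \<sigma>" and "\<And>q. q \<in> symbols \<sigma> \<Longrightarrow> ar q = arity \<sigma> q"
  shows "wf_tree \<sigma> G \<and> ws = tree_words G"
  using assms(1)
proof (induction d arbitrary: G ws)
  case 0
  then show ?case by (auto simp: trees_upto_def)
next
  case (Suc d)
  have "fun_symbol \<sigma> q" if "q \<in> set Q" "\<not> pred_symbol \<sigma> q" for q
    using that assms(2) by (cases "kind \<sigma> q") (auto simp: fun_symbol_def pred_symbol_def)
  moreover have "ar q = arity \<sigma> q" if "q \<in> set Q" for q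
    using that assms(2,3) by auto
  ultimately show ?case
    using Suc.prems Suc.IH
    by (auto simp: trees_upto_def mem_tree_step mem_pred_nodes mem_fun_nodes split: if_splits)
qed

lemma trees_upto_complete:
  assumes "wf_tree \<sigma> G" and "depth G \<le> d" and "tree_symbols G \<subseteq> set Q"
    and "tree_vars G \<subseteq> set V" and "labels G \<subseteq> set L"
    and "\<And>q. q \<in> symbols \<sigma> \<Longrightarrow> ar q = arity \<sigma> q"
  shows "(G, tree_words G) \<in> set (trees_upto (pred_symbol \<sigma>) ar Q V L d)"
  using assms(1-5)
proof (induction G arbitrary: d)
  case (Terminal t)
  then show ?case by (cases d) (auto simp: trees_upto_def mem_tree_step)
next
  case (FunNode j f ls G)
  then obtain d' where d: "d = Suc d'" by (cases d) auto
  let ?cs = "trees_upto (pred_symbol \<sigma>) ar Q V L d'"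
  have "(G, tree_words G) \<in> set ?cs"
    using FunNode d by auto
  moreover have "\<not> pred_symbol \<sigma> f" "ar f = arity \<sigma> f"
    using FunNode.prems assms(6) by (auto simp: pred_symbol_def fun_symbol_def)
  moreover have "trees_upto (pred_symbol \<sigma>) ar Q V L d = tree_step (pred_symbol \<sigma>) ar Q V L ?cs"
    by (simp add: trees_upto_def d)
  ultimately show ?case
    using FunNode.prems by (auto simp: mem_tree_step mem_fun_nodes)
next
  case (PredNode r ls G0 G1)
  then obtain d' where d: "d = Suc d'" by (cases d) auto
  let ?cs = "trees_upto (pred_symbol \<sigma>) ar Q V L d'"
  have "(G0, tree_words G0) \<in> set ?cs" "(G1, tree_words G1) \<in> set ?cs"
    using PredNode d by auto
  moreover have "pred_symbol \<sigma> r" "ar r = arity \<sigma> r"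
    using PredNode.prems assms(6) by (auto simp: pred_symbol_def)
  moreover have "trees_upto (pred_symbol \<sigma>) ar Q V L d = tree_step (pred_symbol \<sigma>) ar Q V L ?cs"
    by (simp add: trees_upto_def d)
  ultimately show ?case
    using PredNode.prems
    by (auto simp: mem_tree_step mem_pred_nodes intro!: exI[of _ r] exI[of _ ls])
qed

lemma computable_on_trees_upto:
  assumes P: "computable_on UNIV P" and ar: "computable_on UNIV ar"
    and "computable_on D Q" and "computable_on D V" and "computable_on D L" and "computable_on D d"
  shows "computable_on D (\<lambda>x. trees_upto P ar (Q x) (V x) (L x) (d x))"
proof -
  have step: "computable_on UNIV (\<lambda>p. tree_step P ar (fst p) (fst (snd p)) (fst (snd (snd p))) (snd (snd (snd p))))"
    unfolding tree_step_def pred_nodes_def fun_nodes_def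
    by (intro computable computable_on_const computable_on_comp[OF P] computable_on_comp[OF ar] UNIV_I)
  have "computable_on UNIV (\<lambda>p. trees_upto P ar (fst p) (fst (snd p)) (fst (snd (snd p))) (snd (snd (snd p))))"
    unfolding trees_upto_def
    by (intro computable computable_on_const UNIV_I
       computable_on_comp[OF step, of _ "\<lambda>p. (fst (fst p), fst (snd (fst p)), fst (snd (snd (fst p))), snd (snd p))", simplified])
  from computable_on_comp[OF this, of D "\<lambda>x. (Q x, V x, L x, d x)"] show ?thesis
    using assms by (simp add: computable)
qed

lemma computable_on_var_bound:
  assumes "computable_on D A" and "computable_on D d"
  shows "computable_on D (\<lambda>x. var_bound (A x) (d x))"
proof -
  have "var_bound a k = rec_nat 0 (\<lambda>_ y. Suc a + (y + y)) k" for a k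
    by (induction k) auto
  then show ?thesis
    by (simp only:) (intro computable computable_on_const assms(2) computable_on_comp[OF assms(1)]; simp)
qed

section \<open>Computability of the signature\<close>

lemma computable_on_symbols: "computable_on UNIV (\<lambda>j. j \<in> symbols \<sigma>)"
proof (cases "sig_size \<sigma>")
  case (enat k)
  have "computable_on UNIV (\<lambda>j. j < k)"
    by (intro computable computable_on_const)
  then show ?thesis by (simp add: symbols_def enat)
next
  case infinity
  then show ?thesis by (simp add: symbols_def computable_on_const)
qed

lemma computable_on_words: "computable_on UNIV (\<lambda>w. w \<in> lists (symbols \<sigma>))"
proof -
  have "w \<in> lists (symbols \<sigma>) \<longleftrightarrow> filter (\<lambda>j. \<not> j \<in> symbols \<sigma>) w = []" for w
    by (auto simp: filter_empty_conv)
  then show ?thesis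
    by (simp only:) (intro computable computable_on_comp[OF computable_on_symbols] UNIV_I)
qed

lemma computable_on_kind_arity:
  assumes "effectively_enumerated \<sigma>"
  shows "computable_on (symbols \<sigma>) (\<lambda>j. (kind \<sigma> j = Predicate, arity \<sigma> j))"
  using assms unfolding effectively_enumerated_def computable_on_def
  by (simp add: encode_bool_def cong: if_cong)

lemma computable_on_pred_symbol:
  assumes "effectively_enumerated \<sigma>"
  shows "computable_on UNIV (pred_symbol \<sigma>)"
proof -
  from computable_on_kind_arity[OF assms]
  have "computable_on (symbols \<sigma>) (\<lambda>j. fst (kind \<sigma> j = Predicate, arity \<sigma> j))"
    by (rule computable)
  then have "computable_on {j \<in> UNIV. j \<in> symbols \<sigma>} (\<lambda>j. kind \<sigma> j = Predicate)"
    by simp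
  then show ?thesis
    unfolding pred_symbol_def by (rule computable_on_conj[OF computable_on_symbols])
qed

lemma computable_on_arity:
  assumes "effectively_enumerated \<sigma>"
  shows "computable_on UNIV (\<lambda>j. if j \<in> symbols \<sigma> then arity \<sigma> j else 0)"
proof -
  from computable_on_kind_arity[OF assms]
  have "computable_on (symbols \<sigma>) (\<lambda>j. snd (kind \<sigma> j = Predicate, arity \<sigma> j))"
    by (rule computable)
  then show ?thesis
    by (intro computable_on_if_domain computable_on_symbols) simp
qed

lemma computable_on_measure:
  assumes "strictly_limited \<sigma> \<psi>"
  shows "computable_on UNIV (\<lambda>w. if w \<in> lists (symbols \<sigma>) then \<psi> w else 0)"
proof (intro computable_on_if_domain computable_on_words)
  show "computable_on (lists (symbols \<sigma>)) \<psi>"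
    using assms
    by (simp add: strictly_limited_def computable_measure_def computable_on_def encode_nat_list)
qed

definition light_symbols :: "signature \<Rightarrow> (nat list \<Rightarrow> nat) \<Rightarrow> nat \<Rightarrow> nat set" where
  "light_symbols \<sigma> \<psi> N = {j \<in> symbols \<sigma>. \<psi> [j] \<le> N}"

text \<open>Knowing the number of symbols of measure at most \<open>N\<close>, a search through \<open>q\<^sub>0, q\<^sub>1, \<dots>\<close> can
  stop as soon as it has met that many of them.\<close>
lemma light_symbols_computable:
  assumes "strictly_limited \<sigma> \<psi>" and K: "total_recursive (K_psi \<sigma> \<psi>)"
  obtains Q where "computable_on UNIV Q" and "\<And>N. set (Q N) = light_symbols \<sigma> \<psi> N"
proof -
  define P where "P N j \<longleftrightarrow> j \<in> symbols \<sigma> \<and> (if [j] \<in> lists (symbols \<sigma>) then \<psi> [j] else 0) \<le> N" for N j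
  have P_iff: "P N j \<longleftrightarrow> j \<in> light_symbols \<sigma> \<psi> N" for N j
    by (auto simp: P_def light_symbols_def)
  \<comment> \<open>\<open>K_psi\<close> converges only at finite classes, so its totality makes all
    of them finite.\<close>
  have fin: "finite (omega_psi \<sigma> \<psi> i)" for i
    using K by (simp add: total_recursive_def K_psi_def split: if_splits)
  then have card_comp: "computable_on UNIV (\<lambda>i. card (omega_psi \<sigma> \<psi> i))"
    using K unfolding computable_on_def total_recursive_def by (auto simp: K_psi_def)
  have light: "light_symbols \<sigma> \<psi> N = (\<Union>i\<in>{..<Suc N}. omega_psi \<sigma> \<psi> i)" for N
    by (auto simp: light_symbols_def omega_psi_def)
  have fin_light: "finite (light_symbols \<sigma> \<psi> N)" for N
    unfolding light using fin by blast
  \<comment> \<open>Classes for different values of the measure are disjoint, so the values of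
    \<open>K_psi\<close> from 0 to \<open>N\<close> add up.\<close>
  have card_light: "card (light_symbols \<sigma> \<psi> N) = sum_list (map (\<lambda>i. card (omega_psi \<sigma> \<psi> i)) [0..<Suc N])"
    for N
  proof -
    have "card (light_symbols \<sigma> \<psi> N) = (\<Sum>i\<in>{..<Suc N}. card (omega_psi \<sigma> \<psi> i))"
      unfolding light by (rule card_UN_disjoint) (auto simp: fin, auto simp: omega_psi_def)
    then show ?thesis
      by (simp add: interv_sum_list_conv_sum_set_nat atLeast0LessThan del: upt_Suc)
  qed
  define found where "found N m \<longleftrightarrow> length (filter (P N) [0..<m]) =
      sum_list (map (\<lambda>i. card (omega_psi \<sigma> \<psi> i)) [0..<Suc N])" for N m
  \<comment> \<open>A subset of a finite set with the same cardinality is the whole set. Comparing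
    two computable numbers thus certifies that no light symbol has index \<open>m\<close> or
    more.\<close>
  have found_iff: "found N m \<longleftrightarrow> light_symbols \<sigma> \<psi> N \<subseteq> {..<m}" for N m
  proof -
    have "length (filter (P N) [0..<m]) = card (light_symbols \<sigma> \<psi> N \<inter> {..<m})"
      by (subst distinct_card[symmetric]) (auto simp: P_iff intro!: arg_cong[where f = card])
    then show ?thesis
      unfolding found_def card_light[symmetric]
      using card_subset_eq[OF fin_light, of "light_symbols \<sigma> \<psi> N \<inter> {..<m}" N]
      by (auto simp: Int_absorb2)
  qed
  have ex: "\<exists>m. found N m" for N
    unfolding found_iff using fin_light finite_nat_iff_bounded by blast
  have P: "computable_on UNIV (\<lambda>p. P (fst p) (snd p))"
    unfolding P_def
    by (intro computable computable_on_const computable_on_comp[OF computable_on_symbols]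
       computable_on_comp[OF computable_on_measure[OF assms(1)]] UNIV_I)
  define Q where "Q N = filter (P N) [0..<(LEAST m. found N m)]" for N
  have "computable_on UNIV (\<lambda>N. LEAST m. found N m)"
    by (rule computable_on_Least)
     (unfold found_def, intro computable computable_on_const computable_on_comp[OF card_comp] UNIV_I
       computable_on_comp[OF P, of _ "\<lambda>p. (fst (fst p), snd p)", simplified], fold found_def, rule ex)
  then have "computable_on UNIV Q"
    unfolding Q_def by (intro computable computable_on_comp[OF P, of _ "\<lambda>p. p", simplified])
  moreover have "set (Q N) = light_symbols \<sigma> \<psi> N" for N
    using found_iff[of N "LEAST m. found N m"] LeastI_ex[OF ex[of N]] by (auto simp: Q_def P_iff)
  ultimately show ?thesis using that by blast
qed

section \<open>Selection of an optimal tree\<close>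

lemma foldr_max_eq_Max:
  "ws \<noteq> [] \<Longrightarrow> foldr (\<lambda>w. max (f w)) ws (0::nat) = Max (f ` set ws)"
  by (induction ws rule: list_nonempty_induct) simp_all

lemma fold_argmin:
  fixes l :: "(nat \<times> 'b) list" and b :: "nat \<times> 'b"
  defines "g \<equiv> \<lambda>c b :: nat \<times> 'b. if fst c < fst b then c else b"
  shows "fold g l b \<in> insert b (set l) \<and> (\<forall>c\<in>insert b (set l). fst (fold g l b) \<le> fst c)"
proof (induction l arbitrary: b)
  case (Cons a l)
  show ?case
  proof (cases "fst a < fst b")
    case True
    then have "fold g (a # l) b = fold g l a" by (simp add: g_def)
    then show ?thesis using Cons.IH[of a] True by auto
  next
    case False
    then have "fold g (a # l) b = fold g l b" by (simp add: g_def)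
    then show ?thesis using Cons.IH[of b] False by auto
  qed
qed simp

theorem theorem5:
  fixes \<sigma> :: signature
    and \<psi> :: "nat list \<Rightarrow> nat"
    and C :: "'a struct set"
    and H :: "fm set"
  assumes "\<exists>r. pred_symbol \<sigma> r" and "effectively_enumerated \<sigma>"
    and "strictly_limited \<sigma> \<psi>"
    and "total_recursive (K_psi \<sigma> \<psi>)"
    and "C \<noteq> {}" and "\<forall>U\<in>C. is_struct \<sigma> U"
    and "H \<noteq> {}" and "H \<subseteq> sentences \<sigma>"
    and "solvability_decidable (Probl \<sigma>) (Tree \<sigma>) H C"
  shows "optimization_decidable \<sigma> \<psi> H C"
proof -
  note sl = assms(3)
  obtain F where "partrec F" and F: "\<And>\<alpha> s S. \<alpha> \<in> H \<Longrightarrow> s \<in> Probl \<sigma> \<Longrightarrow> S \<in> Tree \<sigma> \<Longrightarrow>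
      F (prod_encode (enc_fm \<alpha>, prod_encode (enc_probl_scheme s, enc_tree_scheme S))) =
        Some (if solves S s (models_class C \<alpha>) then 1 else 0)"
    using assms(9) unfolding solvability_decidable_def by blast
  obtain Q where Q: "computable_on UNIV Q" "\<And>N. set (Q N) = light_symbols \<sigma> \<psi> N"
    using light_symbols_computable[OF sl assms(4)] by blast
  define ar where "ar j = (if j \<in> symbols \<sigma> then arity \<sigma> j else 0)" for j
  define \<psi>' where "\<psi>' w = (if w \<in> lists (symbols \<sigma>) then \<psi> w else 0)" for w
  have ar: "computable_on UNIV ar"
    using computable_on_arity[OF assms(2)] by (simp add: ar_def[abs_def])
  have \<psi>': "computable_on UNIV \<psi>'"
    using computable_on_measure[OF sl] by (simp add: \<psi>'_def[abs_def])

  \<comment> \<open>Data of the algorithm\<close>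
  define problem where "problem s = (case s of (n, \<nu>, \<beta>) \<Rightarrow>
      (n, map \<nu> (List.n_lists (length (pred_positions \<beta>)) [False, True]), \<beta>))"
    for s :: probl_scheme
  have encode_problem: "encode (problem s) = enc_probl_scheme s" for s
    by (simp add: problem_def enc_probl_scheme_def encode_nat_list encode_expr_list split: prod.split)
  \<comment> \<open>The admissible inputs, with \<open>\<nu>\<close> replaced by its finite
    table.\<close>
  define D where "D = {(enc_fm \<alpha>, problem s) | \<alpha> s. \<alpha> \<in> H \<and> s \<in> Probl \<sigma>}"

  \<comment> \<open>The cost of the decision tree of the given problem, later an upper bound for the
    optimum.\<close>
  define N where "N x = \<psi>' (map symbol (snd (snd (snd x))))"
    for x :: "nat \<times> nat \<times> nat list \<times> expr list"
  \<comment> \<open>The sum of the arities of all light symbols serves as a common bound for each of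
    them.\<close>
  define V where "V x = [0..<fst (snd x) + var_bound (sum_list (map ar (Q (N x)))) (N x)]"
    for x :: "nat \<times> nat \<times> nat list \<times> expr list"
  define trees where "trees x = trees_upto (pred_symbol \<sigma>) ar (Q (N x)) (V x) (fst (snd (snd x))) (N x)"
    for x :: "nat \<times> nat \<times> nat list \<times> expr list"
  \<comment> \<open>Defined through the answer of \<open>F\<close>, so that it makes sense for any
    \<open>x\<close>; on admissible inputs and well-formed trees \<open>accepted_iff\<close>
    identifies it with \<open>solves\<close>.\<close>
  define accepted where "accepted x G \<longleftrightarrow>
      F (prod_encode (fst x, prod_encode (encode (snd x), prod_encode (fst (snd x), encode G)))) = Some 1"
    for x :: "nat \<times> nat \<times> nat list \<times> expr list" and G :: tree
  define solutions where "solutions x = map (\<lambda>c. (foldr (\<lambda>w. max (\<psi>' w)) (snd c) 0, fst c))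
      (filter (\<lambda>c. accepted x (fst c)) (trees x))" for x
  \<comment> \<open>Starting from the head keeps the minimum inside the list; \<open>optimal\<close>
    supplies nonemptiness for inputs in \<open>D\<close>.\<close>
  define best where "best x = fold (\<lambda>c b. if fst c < fst b then c else b) (solutions x) (hd (solutions x))"
    for x

  have wf: "wf_tree \<sigma> G \<and> ws = tree_words G" if "(G, ws) \<in> set (trees x)" for G ws x
    using trees_upto_sound[OF that[unfolded trees_def]] Q(2) by (auto simp: light_symbols_def ar_def)
  have accepted_iff: "accepted (enc_fm \<alpha>, problem s) G \<longleftrightarrow> solves (fst s, G) s (models_class C \<alpha>)"
    and accepted_code: "F (prod_encode (enc_fm \<alpha>, prod_encode (encode (problem s), prod_encode (fst s, encode G)))) =
      Some (encode (accepted (enc_fm \<alpha>, problem s) G))"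
    if "\<alpha> \<in> H" "s \<in> Probl \<sigma>" "wf_tree \<sigma> G" for \<alpha> s G
  proof -
    have "(fst s, G) \<in> Tree \<sigma>"
      using that by (auto simp: Tree_def Probl_def)
    moreover have "fst (problem s) = fst s"
      by (simp add: problem_def split: prod.split)
    ultimately have *: "F (prod_encode (enc_fm \<alpha>, prod_encode (encode (problem s),
        prod_encode (fst (problem s), encode G)))) =
        Some (if solves (fst s, G) s (models_class C \<alpha>) then 1 else 0)"
      using F[OF that(1,2), of "(fst s, G)"]
      by (simp add: enc_tree_scheme_def encode_problem encode_tree_def)
    then show "accepted (enc_fm \<alpha>, problem s) G \<longleftrightarrow> solves (fst s, G) s (models_class C \<alpha>)"
      by (simp add: accepted_def)
    with * \<open>fst (problem s) = fst s\<close>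
    show "F (prod_encode (enc_fm \<alpha>, prod_encode (encode (problem s), prod_encode (fst s, encode G)))) =
        Some (encode (accepted (enc_fm \<alpha>, problem s) G))"
      by (simp add: encode_bool_def)
  qed

  \<comment> \<open>Correctness of the selection\<close>
  have optimal: "solutions x \<noteq> [] \<and> optimal_solution \<sigma> \<psi> (fst (snd x), snd (best x)) s (models_class C \<alpha>)"
    if x: "x = (enc_fm \<alpha>, problem s)" and \<alpha>: "\<alpha> \<in> H" and s: "s \<in> Probl \<sigma>" for x \<alpha> s
  proof -
    obtain n \<nu> \<beta> where s_eq: "s = (n, \<nu>, \<beta>)" by (cases s)
    have n: "n \<ge> 1" and \<beta>: "\<forall>b\<in>set \<beta>. wf_expr \<sigma> b"
      using s by (auto simp: s_eq Probl_def)
    have "word \<beta> \<in> lists (symbols \<sigma>)"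
      using \<beta> by (force simp: word_def fun_symbol_def pred_symbol_def elim!: wf_expr.elims)
    then have N: "N x = \<psi> (word \<beta>)"
      by (simp add: N_def x problem_def s_eq \<psi>'_def word_def)
    have mem_solutions: "(k, G) \<in> set (solutions x) \<longleftrightarrow> (G, tree_words G) \<in> set (trees x) \<and>
        solves (n, G) s (models_class C \<alpha>) \<and> k = tree_complexity \<psi> (n, G)" for k G
    proof -
      have "foldr (\<lambda>w. max (\<psi>' w)) (tree_words G) 0 = tree_complexity \<psi> (n, G)" if "wf_tree \<sigma> G"
      proof -
        have "\<psi>' ` set (tree_words G) = \<psi> ` set (tree_words G)"
          using tree_words_in_lists[OF that] by (intro image_cong) (auto simp: \<psi>'_def)
        then show ?thesis
          by (simp add: foldr_max_eq_Max[OF tree_words_nonempty] tree_complexity_eq)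
      qed
      moreover have "accepted x G \<longleftrightarrow> solves (n, G) s (models_class C \<alpha>)" if "wf_tree \<sigma> G"
        using accepted_iff[OF \<alpha> s that] by (simp add: x s_eq)
      moreover have "(k, G) \<in> set (solutions x) \<longleftrightarrow>
          (\<exists>ws. (G, ws) \<in> set (trees x) \<and> accepted x G \<and> k = foldr (\<lambda>w. max (\<psi>' w)) ws 0)"
        by (force simp: solutions_def)
      ultimately show ?thesis
        using wf[of G _ x] by metis
    qed
    \<comment> \<open>The listed tree need not be \<open>G\<close> itself: it is a renamed copy with
      the same words, hence with the same complexity.\<close>
    have covered: "\<exists>k G'. (k, G') \<in> set (solutions x) \<and> k = tree_complexity \<psi> (n, G)"
      if G: "wf_tree \<sigma> G" "solves (n, G) s (models_class C \<alpha>)"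
        and le: "\<And>w. w \<in> set (tree_words G) \<Longrightarrow> \<psi> w \<le> N x" for G
    proof -
      have light: "tree_symbols G \<subseteq> set (Q (N x))"
      proof
        fix q assume "q \<in> tree_symbols G"
        then obtain w where w: "w \<in> set (tree_words G)" "q \<in> set w"
          by (auto simp: tree_symbols_def)
        then have "w \<in> lists (symbols \<sigma>)"
          using tree_words_in_lists[OF G(1)] by blast
        then show "q \<in> set (Q (N x))"
          using symbol_measure_le[OF sl, of w q] w le[of w] by (auto simp: Q light_symbols_def)
      qed
      have depth: "depth G \<le> N x"
        using depth_attained[of G] tree_words_in_lists[OF G(1)] length_le_measure[OF sl] le
        by (metis le_trans subsetD)
      have arity: "arity \<sigma> q \<le> sum_list (map ar (Q (N x)))" if "q \<in> tree_symbols G" for q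
      proof -
        have "arity \<sigma> q = ar q"
          using that tree_symbols_subset[OF G(1)] by (auto simp: ar_def)
        then show ?thesis
          using that light member_le_sum_list[of "ar q" "map ar (Q (N x))"] by auto
      qed
      obtain G' where G': "wf_tree \<sigma> G'" "tree_words G' = tree_words G"
        "tree_vars G' \<subseteq> {..<n + var_bound (sum_list (map ar (Q (N x)))) (N x)}"
        "labels G' \<subseteq> \<nu> ` {bs. length bs = length (pred_positions \<beta>)}"
        "solves (n, G') (n, \<nu>, \<beta>) (models_class C \<alpha>)"
        using solution_with_bounded_variables[OF G(1) n G(2)[unfolded s_eq] depth arity refl] by blast
      have "(G', tree_words G') \<in> set (trees x)"
        unfolding trees_def
      proof (rule trees_upto_complete[OF G'(1)])
        show "depth G' \<le> N x"
          using depth_attained[of G'] tree_words_in_lists[OF G'(1)] length_le_measure[OF sl] le G'(2)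
          by (metis le_trans subsetD)
        show "tree_symbols G' \<subseteq> set (Q (N x))"
          using light G'(2) by (simp add: tree_symbols_def)
        show "tree_vars G' \<subseteq> set (V x)"
          using G'(3) by (auto simp: V_def x problem_def s_eq)
        show "labels G' \<subseteq> set (fst (snd (snd x)))"
          using G'(4) by (auto simp: x problem_def s_eq set_n_lists)
      qed (simp add: ar_def)
      then have "(tree_complexity \<psi> (n, G'), G') \<in> set (solutions x)"
        using G'(5) by (simp add: mem_solutions s_eq)
      then show ?thesis
        using G'(2) by (auto simp: tree_complexity_eq)
    qed
    \<comment> \<open>The decision tree has \<open>word \<beta>\<close> as its only word, so
      \<open>covered\<close> applies to it and yields a candidate of cost exactly
      \<open>N x\<close>.\<close>
    have dt: "\<exists>G'. (N x, G') \<in> set (solutions x)"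
      using covered[of "decision_tree \<nu> \<beta>"]
      by (auto simp: wf_decision_tree[OF \<beta>] solves_decision_tree s_eq tree_words_decision_tree N
          tree_complexity_eq)
    then have nonempty: "solutions x \<noteq> []" by auto
    have best: "best x \<in> set (solutions x)" "\<And>c. c \<in> set (solutions x) \<Longrightarrow> fst (best x) \<le> fst c"
      using fold_argmin[of "solutions x" "hd (solutions x)"] nonempty
      by (auto simp: best_def insert_absorb)
    then have sol: "(snd (best x), tree_words (snd (best x))) \<in> set (trees x)"
      "solves (n, snd (best x)) s (models_class C \<alpha>)"
      "fst (best x) = tree_complexity \<psi> (n, snd (best x))"
      using mem_solutions[of "fst (best x)" "snd (best x)"] by auto
    have "tree_complexity \<psi> (n, snd (best x)) \<le> tree_complexity \<psi> S'"
      if S': "S' \<in> Tree \<sigma>" "solves S' s (models_class C \<alpha>)" for S'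
    proof -
      obtain G where G: "S' = (n, G)" "wf_tree \<sigma> G"
        using S' by (cases S') (auto simp: Tree_def solves_def s_eq)
      have words: "\<psi> w \<le> tree_complexity \<psi> S'" if "w \<in> set (tree_words G)" for w
        using that by (simp add: G(1) tree_complexity_eq)
      have "\<exists>k G'. (k, G') \<in> set (solutions x) \<and> k \<le> tree_complexity \<psi> S'"
      \<comment> \<open>A competitor of cost at most \<open>N x\<close> has a listed tree of equal
        cost; a more expensive one is beaten by the candidate from \<open>dt\<close>.\<close>
      proof (cases "tree_complexity \<psi> S' \<le> N x")
        case True
        then show ?thesis
          using covered[of G] words S'(2) G by (metis order.refl le_trans)
      next
        case False
        then show ?thesis
          using dt by (meson nle_le)
      qed
      then show ?thesis
        using best(2) sol(3) by fastforce
    qed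
    moreover have "(n, snd (best x)) \<in> Tree \<sigma>"
      using wf[OF sol(1)] n by (simp add: Tree_def)
    moreover have "fst (snd x) = n"
      by (simp add: x problem_def s_eq)
    ultimately show ?thesis
      using sol(2) nonempty by (simp add: optimal_solution_def)
  qed

  \<comment> \<open>Computability of the selection\<close>
  have comp_N: "computable_on UNIV N"
    unfolding N_def by (intro computable computable_on_comp[OF \<psi>'] UNIV_I)
  have comp_trees: "computable_on UNIV trees"
    unfolding trees_def V_def
    by (intro computable computable_on_trees_upto computable_on_pred_symbol[OF assms(2)] ar
        computable_on_var_bound computable_on_comp[OF Q(1)] computable_on_comp[OF ar]
        computable_on_comp[OF comp_N] UNIV_I)
  \<comment> \<open>The behaviour of \<open>F\<close> is known only on codes of admissible triples,
    hence the restriction to \<open>D\<close> and to well-formed trees.\<close>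
  have comp_accepted: "computable_on {p. fst p \<in> D \<and> wf_tree \<sigma> (snd p)} (\<lambda>p. accepted (fst p) (snd p))"
  proof (rule computable_on_partrec[OF \<open>partrec F\<close>])
    show "computable_on {p. fst p \<in> D \<and> wf_tree \<sigma> (snd p)} (\<lambda>p. (fst (fst p), encode (snd (fst p)),
        fst (snd (fst p)), encode (snd p)))"
      by (intro computable)
  next
    fix p assume "p \<in> {p. fst p \<in> D \<and> wf_tree \<sigma> (snd p)}"
    then obtain \<alpha> s where "fst p = (enc_fm \<alpha>, problem s)" "\<alpha> \<in> H" "s \<in> Probl \<sigma>" "wf_tree \<sigma> (snd p)"
      by (auto simp: D_def)
    moreover have "fst (problem s) = fst s"
      by (simp add: problem_def split: prod.split)
    ultimately show "F (encode (fst (fst p), encode (snd (fst p)), fst (snd (fst p)), encode (snd p))) =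
        Some (encode (accepted (fst p) (snd p)))"
      using accepted_code[of \<alpha> s "snd p"] by simp
  qed
  \<comment> \<open>By \<open>wf\<close>, every enumerated tree is well-formed, so the filter calls
    \<open>accepted\<close> only within its domain.\<close>
  have comp_solutions: "computable_on D solutions"
    unfolding solutions_def
    by (intro computable computable_on_const computable_on_comp[OF \<psi>']
       computable_on_subset[OF comp_trees] UNIV_I subset_UNIV
       computable_on_comp[OF comp_accepted, of _ "\<lambda>p. (fst p, fst (snd p))", simplified])
      (use wf in \<open>auto simp del: split_paired_All\<close>)
  have "computable_on D best"
    unfolding best_def
  proof (intro computable comp_solutions)
    show "solutions x \<noteq> []" if "x \<in> D" for x
      using that optimal unfolding D_def by blast
  qed
  then have "computable_on D (\<lambda>x. (fst (snd x), snd (best x)))"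
    by (intro computable)
  then obtain g where "partrec g"
    and g: "\<And>x. x \<in> D \<Longrightarrow> g (encode x) = Some (encode (fst (snd x), snd (best x)))"
    unfolding computable_on_def by blast
  have "\<exists>S. g (prod_encode (enc_fm \<alpha>, enc_probl_scheme s)) = Some (enc_tree_scheme S) \<and>
      optimal_solution \<sigma> \<psi> S s (models_class C \<alpha>)" if "\<alpha> \<in> H" "s \<in> Probl \<sigma>" for \<alpha> s
  proof -
    have "(enc_fm \<alpha>, problem s) \<in> D"
      using that unfolding D_def by blast
    from g[OF this] optimal[OF refl that] show ?thesis
      by (auto simp: encode_problem enc_tree_scheme_def encode_tree_def)
  qed
  then show ?thesis
    unfolding optimization_decidable_def using \<open>partrec g\<close> by blast
qed

end
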